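(* Let $c = 1/800$. For all constants $0 < C_1 \leq C_2$ there exists $n_0\in\mathbb{N}$ such that for every integer $n \geq n_0$, every prime $p \leq \exp(c\sqrt{n\log n})$ and every real $\beta$ with $C_1 n/p \leq \beta \leq C_2 n/p$, \[ \sum_{v \in \mathbb{Z}_p^n\setminus\{0\} \,:\, \rho(v)\geq\beta} \ \max_{w\in\mathbb{Z}_p^n} \mathbb{P}(Mv = w) \leq e^{-cn}, \] where $M$ is drawn uniformly at random from all symmetric $n\times n$ matrices with entries in $\{-1,1\}$ and the product $Mv$ is computed over $\mathbb{Z}_p$.
   Context: $\mathbb{Z}_p$ is the field of integers modulo $p$ and $\log$ is the natural logarithm. For $v=(v_1,\dots,v_n)\in\mathbb{Z}_p^n$, $\rho(v) := \max_{x\in\mathbb{Z}_p}\mathbb{P}(\varepsilon_1v_1+\cdots+\varepsilon_nv_n = x)$, where $\varepsilon_1,\dots,\varepsilon_n$ are i.i.d. uniform on $\{-1,1\}$ and the sum is taken in $\mathbb{Z}_p$. *)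

theory Defs
  imports "HOL-Probability.Probability" "Jordan_Normal_Form.Matrix"
begin

text \<open>Elements of the prime field are represented by the integers in \<open>{0..<int p}\<close>; arithmetic
  in the field is integer arithmetic followed by reduction modulo \<open>p\<close>.  Since the modulus and the
  dimension are quantified inside the theorem, neither of them is a type.\<close>

definition Zp_vec :: "nat \<Rightarrow> nat \<Rightarrow> int vec set" where
  "Zp_vec p n = {v \<in> carrier_vec n. \<forall>i<n. vec_index v i \<in> {0..<int p}}"

definition sign_seq_pmf :: "nat \<Rightarrow> (nat \<Rightarrow> int) pmf" where
  "sign_seq_pmf n = Pi_pmf {..<n} 0 (\<lambda>_. pmf_of_set {-1, 1})"

definition rho :: "nat \<Rightarrow> int vec \<Rightarrow> real" where
  "rho p v = Max ((\<lambda>x. measure_pmf.prob (sign_seq_pmf (dim_vec v))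
       {\<epsilon>. (\<Sum>i<dim_vec v. \<epsilon> i * vec_index v i) mod int p = x}) ` {0..<int p})"

definition sym_sign_mats :: "nat \<Rightarrow> int mat set" where
  "sym_sign_mats n =
     {M \<in> carrier_mat n n. transpose_mat M = M \<and> (\<forall>i<n. \<forall>j<n. M $$ (i, j) \<in> {-1, 1})}"

text \<open>The set of matrices is finite and nonempty (also for \<open>n = 0\<close>), as required for
  \<^const>\<open>pmf_of_set\<close> to be the uniform distribution.\<close>

lemma finite_sym_sign_mats: "finite (sym_sign_mats n)"
proof (rule finite_subset)
  show "sym_sign_mats n \<subseteq>
      (\<lambda>f. mat n n f) ` (({..<n} \<times> {..<n}) \<rightarrow>\<^sub>E {-1, 1})"
  proof
    fix M assume M: "M \<in> sym_sign_mats n"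
    let ?f = "restrict (\<lambda>ij. M $$ ij) ({..<n} \<times> {..<n})"
    have "M = mat n n ?f"
      using M by (intro eq_matI) (auto simp: sym_sign_mats_def)
    moreover have "?f \<in> ({..<n} \<times> {..<n}) \<rightarrow>\<^sub>E {-1, 1}"
      using M by (auto simp: sym_sign_mats_def)
    ultimately show "M \<in> (\<lambda>f. mat n n f) ` (({..<n} \<times> {..<n}) \<rightarrow>\<^sub>E {-1, 1})"
      by blast
  qed
qed (intro finite_imageI finite_PiE finite_cartesian_product finite_lessThan, auto)

lemma sym_sign_mats_nonempty: "sym_sign_mats n \<noteq> {}"
proof -
  have "mat n n (\<lambda>_. 1) \<in> sym_sign_mats n"
    by (auto simp: sym_sign_mats_def intro!: eq_matI)
  then show ?thesis by blast
qed

lemma finite_Zp_vec: "finite (Zp_vec p n)"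
proof (rule finite_subset)
  show "Zp_vec p n \<subseteq> (\<lambda>f. vec n f) ` ({..<n} \<rightarrow>\<^sub>E {0..<int p})"
  proof
    fix v assume v: "v \<in> Zp_vec p n"
    let ?f = "restrict (vec_index v) {..<n}"
    have "v = vec n ?f"
      using v by (intro eq_vecI) (auto simp: Zp_vec_def)
    moreover have "?f \<in> {..<n} \<rightarrow>\<^sub>E {0..<int p}"
      using v by (auto simp: Zp_vec_def)
    ultimately show "v \<in> (\<lambda>f. vec n f) ` ({..<n} \<rightarrow>\<^sub>E {0..<int p})"
      by blast
  qed
qed (intro finite_imageI finite_PiE, auto)

end

theory Submission
  imports Defs "HOL-Number_Theory.Cong" "HOL-Real_Asymp.Real_Asymp"
begin

text \<open>A symmetric sign matrix sends \<open>v\<close> to a prescribed vector with probability at most a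
  product of concentration probabilities of the tails \<open>drop k u\<close> of a list
  \<open>u\<close> of the entries of \<open>v\<close>: revealing the rows one after the other,
  each row meets fresh randomness in the columns that come after it
  (\<open>symmetric_rows_prob_le\<close>). Each such concentration probability is at most the
  return probability \<open>return_prob\<close> of the lazy walk that makes every step
  \<open>\<plusminus>a\<close> with probability \<open>1/8\<close> each, for every entry
  \<open>a\<close> (\<open>sign_sum_prob_le\<close>). The gain of the lazy walk is that its
  Fourier transform is positive, so that return probabilities can only drop when steps are added.

  It remains to sum the product over all \<open>v\<close>. The list \<open>u\<close> is built from
  its end, one entry at a time. Call \<open>x\<close> a neighbour of a list \<open>T\<close> if
  the walk with steps \<open>T\<close> hits \<open>x\<close> with more than half of its return
  probability \<open>q(T)\<close>. There are at most \<open>2/q(T)\<close> neighbours, and adding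
  a non-neighbour to \<open>T\<close> shrinks \<open>q(T)\<close> by a constant factor, which can
  happen only \<open>O(log p)\<close> times. So keep \<open>k\<close> disjoint sublists
  \<open>T\<^sub>0, \<dots>, T\<^sub>k\<^sub>-\<^sub>1\<close>, and put a new entry into the first
  one of which it is not a neighbour. Counting choices of the new entry against the return
  probability that it contributes, there are three cases: an entry that joins
  \<open>T\<^sub>0\<close> costs a factor \<open>p\<close>, but this happens only \<open>O(log
  p)\<close> times; an entry that joins a later sublist is a neighbour of \<open>T\<^sub>0\<close>
  and costs only a constant; an entry that joins none of them is a common neighbour of all
  \<open>T\<^sub>j\<close> and gains a power of \<open>k\<close>. The last case is the typical
  one.

  The gain comes from an inequality of Halasz type
  (\<open>exists_return_prob_of_product_le\<close>): the return probability of the walk with the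
  steps of \<open>k\<close> disjoint nonempty lists is smaller by a power of \<open>k\<close> than
  the largest of their individual return probabilities, up to an additive \<open>1/p\<close>. The
  hypothesis that \<open>\<rho>(v)\<close> is at least of order \<open>n/p\<close> makes this
  \<open>1/p\<close> negligible.

  The cost \<open>p ^ O(log p)\<close> is \<open>exp (n log n / 80000)\<close> up to lower order
  terms, and the gain is a power \<open>n ^ (- n / 168)\<close>, which wins. The argument needs at
  least \<open>k\<close> nonzero entries, where \<open>k\<close> is a small power of
  \<open>n\<close>; there are so few vectors with fewer that the trivial bound \<open>(3/4) ^
  n\<close> for each of them is enough.\<close>

section \<open>Lazy random walks and their Fourier transforms\<close>

definition phase :: "nat \<Rightarrow> int \<Rightarrow> int \<Rightarrow> real" where
  "phase p a t = cos (2 * pi * of_int (a * t) / real p)"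

text \<open>The Fourier transform of the walk that, for each \<open>a\<close> in \<open>T\<close>, stays put
  with probability \<open>3/4\<close> and moves by \<open>a\<close> or by \<open>- a\<close> with
  probability \<open>1/8\<close> each.\<close>
definition lazy_char :: "nat \<Rightarrow> int list \<Rightarrow> int \<Rightarrow> real" where
  "lazy_char p T t = (\<Prod>a\<leftarrow>T. 3 / 4 + phase p a t / 4)"

text \<open>The probability that this walk on the residues modulo \<open>p\<close> is at \<open>x\<close>,
  defined by Fourier inversion; the recursion \<open>lazy_prob_Cons\<close> below identifies it.
  Positivity of the transform makes \<open>return_prob\<close>, the value at \<open>0\<close>, the
  largest one.\<close>
definition lazy_prob :: "nat \<Rightarrow> int list \<Rightarrow> int \<Rightarrow> real" where
  "lazy_prob p T x = (\<Sum>t\<in>{0..<int p}. lazy_char p T t * phase p x t) / real p"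

definition return_prob :: "nat \<Rightarrow> int list \<Rightarrow> real" where
  "return_prob p T = (\<Sum>t\<in>{0..<int p}. lazy_char p T t) / real p"

lemma phase_bounds: "phase p a t \<le> 1" "- 1 \<le> phase p a t"
  by (auto simp: phase_def)

lemma phase_0 [simp]: "phase p 0 t = 1" "phase p a 0 = 1"
  by (auto simp: phase_def)

lemma phase_minus: "phase p (- a) t = phase p a t"
  by (simp add: phase_def)

lemma phase_add_minus: "phase p (x - a) t + phase p (x + a) t = 2 * (phase p a t * phase p x t)"
proof -
  define \<alpha> \<xi> where "\<alpha> = 2 * pi * of_int (a * t) / real p" and "\<xi> = 2 * pi * of_int (x * t) / real p"
  have "2 * pi * of_int ((x - a) * t) / real p = \<xi> - \<alpha>" 
    "2 * pi * of_int ((x + a) * t) / real p = \<xi> + \<alpha>"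
    by (simp_all add: \<alpha>_def \<xi>_def algebra_simps add_divide_distrib diff_divide_distrib)
  then show ?thesis
    unfolding phase_def by (simp only: cos_add cos_diff flip: \<alpha>_def \<xi>_def) simp
qed

lemma phase_mod:
  assumes "p > 0" shows "phase p a (t mod int p) = phase p a t"
proof -
  have "real_of_int t = of_int (t mod int p) + real p * of_int (t div int p)"
    by (metis add.commute mult_div_mod_eq of_int_add of_int_mult of_int_of_nat_eq)
  then have "2 * pi * of_int (a * t) / real p = 
      2 * pi * of_int (a * (t mod int p)) / real p + 2 * pi * of_int (a * (t div int p))"
    using assms by (simp add: field_simps)
  then show ?thesis
    unfolding phase_def by (metis cos.plus_of_int of_int_mult cos_add cos_int_2pin sin_int_2pin mult.right_neutral mult_zero_right diff_zero)
qed

text \<open>Orthogonality of characters. Multiplication by \<open>2 sin (\<pi>x/p)\<close> makes the sum of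
  cosines telescope.\<close>
lemma sum_phase:
  assumes "p > 0"
  shows "(\<Sum>t\<in>{0..<int p}. phase p x t) = (if int p dvd x then real p else 0)"
proof (cases "int p dvd x")
  case True
  then obtain y where y: "x = int p * y" by blast
  have "phase p x t = 1" for t
  proof -
    have "2 * pi * of_int (x * t) / real p = 2 * pi * of_int (y * t)"
      using assms by (simp add: y)
    then show ?thesis unfolding phase_def by (metis cos_int_2pin)
  qed
  then show ?thesis using True by simp
next
  case False
  define y where "y = pi * of_int x / real p"
  have "sin y \<noteq> 0"
  proof
    assume "sin y = 0"
    then obtain k :: int where "y = of_int k * pi" by (auto simp: sin_zero_iff_int2)
    then have "real_of_int x = of_int (int p * k)"
      using assms by (simp add: y_def field_simps)
    then show False using False by (simp only: of_int_eq_iff) simp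
  qed
  have tele: "(\<Sum>t<n. 2 * sin y * cos (2 * real t * y)) = sin ((2 * real n - 1) * y) + sin y" for n
  proof (induction n)
    case (Suc n)
    have "2 * sin y * cos (2 * real n * y) = sin ((2 * real n + 1) * y) - sin ((2 * real n - 1) * y)"
      by (simp add: algebra_simps sin_add sin_diff)
    then show ?case using Suc by (simp add: algebra_simps)
  qed simp
  have "(2 * real p - 1) * y = 2 * pi * of_int x - y"
    using assms by (simp add: y_def field_simps)
  then have "sin ((2 * real p - 1) * y) + sin y = 0"
    by (simp add: sin_diff)
  then have "(\<Sum>t<p. cos (2 * real t * y)) = 0"
    using tele[of p] \<open>sin y \<noteq> 0\<close> by (simp flip: sum_distrib_left)
  moreover have "(\<Sum>t\<in>{0..<int p}. phase p x t) = (\<Sum>t<p. phase p x (int t))"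
    by (rule sum.reindex_bij_witness[of _ int nat]) auto
  moreover have "phase p x (int t) = cos (2 * real t * y)" for t
    by (simp add: phase_def y_def field_simps)
  ultimately show ?thesis using False by simp
qed

lemma lazy_char_Nil [simp]: "lazy_char p [] t = 1"
  by (simp add: lazy_char_def)

lemma lazy_char_Cons [simp]:
  "lazy_char p (a # T) t = (3 / 4 + phase p a t / 4) * lazy_char p T t"
  by (simp add: lazy_char_def)

lemma lazy_factor_bounds: "1 / 2 \<le> 3 / 4 + phase p a t / 4" "3 / 4 + phase p a t / 4 \<le> 1"
  using phase_bounds[of p a t] by auto

lemma lazy_char_pos: "lazy_char p T t > 0"
proof (induction T)
  case (Cons a T)
  have "3 / 4 + phase p a t / 4 > 0" using lazy_factor_bounds(1)[of p a t] by linarith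
  with Cons show ?case by simp
qed simp

lemma lazy_char_Cons_le: "lazy_char p (a # T) t \<le> lazy_char p T t"
  using lazy_factor_bounds[of p a t] lazy_char_pos[of p T t] by (simp add: mult_left_le_one_le)

lemma lazy_char_le_1: "lazy_char p T t \<le> 1"
proof (induction T)
  case (Cons a T)
  then show ?case using lazy_char_Cons_le[of p a T t] by linarith
qed simp

lemma lazy_char_at_0: "lazy_char p T 0 = 1"
  by (induction T) auto

lemma lazy_char_mod: "p > 0 \<Longrightarrow> lazy_char p T (t mod int p) = lazy_char p T t"
  by (induction T) (auto simp: phase_mod)

lemma lazy_prob_0: "lazy_prob p T 0 = return_prob p T"
  by (simp add: lazy_prob_def return_prob_def)

lemma lazy_prob_Nil: "p > 0 \<Longrightarrow> lazy_prob p [] x = (if int p dvd x then 1 else 0)"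
  by (simp add: lazy_prob_def sum_phase)

lemma lazy_prob_Cons:
  "lazy_prob p (a # T) x =
    3 / 4 * lazy_prob p T x + 1 / 8 * (lazy_prob p T (x - a) + lazy_prob p T (x + a))"
proof -
  have *: "lazy_char p (a # T) t * phase p x t = 3 / 4 * (lazy_char p T t * phase p x t)
      + 1 / 8 * (lazy_char p T t * phase p (x - a) t + lazy_char p T t * phase p (x + a) t)" for t
  proof -
    have "lazy_char p (a # T) t * phase p x t = 3 / 4 * (lazy_char p T t * phase p x t)
      + 1 / 8 * (lazy_char p T t * (2 * (phase p a t * phase p x t)))"
      by (simp add: algebra_simps)
    then show ?thesis
      unfolding phase_add_minus[symmetric] by (simp only: distrib_left)
  qed
  show ?thesis
    unfolding lazy_prob_def *
    by (simp add: sum.distrib flip: sum_distrib_left sum_divide_distrib) (simp add: add_divide_distrib)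
qed

lemma lazy_prob_minus: "lazy_prob p T (- x) = lazy_prob p T x"
  by (simp add: lazy_prob_def phase_minus)

lemma lazy_prob_nonneg: "p > 0 \<Longrightarrow> lazy_prob p T x \<ge> 0"
  by (induction T arbitrary: x) (auto simp: lazy_prob_Nil lazy_prob_Cons)

lemma sum_lazy_prob:
  assumes "p > 0" shows "(\<Sum>x\<in>{0..<int p}. lazy_prob p T x) = 1"
proof -
  have "(\<Sum>x\<in>{0..<int p}. lazy_prob p T x)
      = (\<Sum>t\<in>{0..<int p}. lazy_char p T t * (\<Sum>x\<in>{0..<int p}. phase p t x)) / real p"
    unfolding lazy_prob_def sum_divide_distrib[symmetric] sum_distrib_left
    by (subst sum.swap) (simp add: phase_def mult.commute)
  also have "\<dots> = (\<Sum>t\<in>{0..<int p}. if t = 0 then real p else 0) / real p"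
    using assms by (intro arg_cong2[where f = "(/)"] sum.cong)
      (auto simp: sum_phase lazy_char_at_0 dest: zdvd_imp_le)
  also have "\<dots> = 1" using assms by simp
  finally show ?thesis .
qed

lemma return_prob_pos: "p > 0 \<Longrightarrow> return_prob p T > 0"
  by (auto simp: return_prob_def lazy_char_pos intro!: divide_pos_pos sum_pos)

lemma return_prob_mono:
  assumes "\<And>t. lazy_char p T t \<le> lazy_char p T' t"
  shows "return_prob p T \<le> return_prob p T'"
  by (auto simp: return_prob_def intro!: divide_right_mono sum_mono assms)

lemma return_prob_le_1: "return_prob p T \<le> 1"
proof (cases "p = 0")
  case False
  have "return_prob p T \<le> return_prob p []"
    by (rule return_prob_mono) (simp add: lazy_char_le_1)
  also have "\<dots> = 1" using False by (simp add: return_prob_def)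
  finally show ?thesis .
qed (simp add: return_prob_def)

lemma return_prob_Nil: "p > 0 \<Longrightarrow> return_prob p [] = 1"
  by (simp add: return_prob_def)

lemma return_prob_Cons: "return_prob p (a # T) = 3 / 4 * return_prob p T + 1 / 4 * lazy_prob p T a"
  using lazy_prob_Cons[of p a T 0] lazy_prob_minus[of p T a] by (simp add: lazy_prob_0)

definition neighbours :: "nat \<Rightarrow> int list \<Rightarrow> int set" where
  "neighbours p T = {x \<in> {0..<int p}. lazy_prob p T x > return_prob p T / 2}"

lemma finite_neighbours [simp]: "finite (neighbours p T)"
  by (rule finite_subset[of _ "{0..<int p}"]) (auto simp: neighbours_def)

text \<open>In particular a list of which a nonzero residue is a neighbour is nonempty.\<close>
lemma neighbours_Nil: "neighbours p [] \<subseteq> {0}"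
proof
  fix x assume "x \<in> neighbours p []"
  then have "0 \<le> x" "x < int p" "int p dvd x"
    by (auto simp: neighbours_def lazy_prob_Nil return_prob_Nil split: if_splits)
  then show "x \<in> {0}" using zdvd_not_zless[of x "int p"] by force
qed

text \<open>The walk is at each neighbour with probability more than half of its return probability, and all
  these probabilities add up to at most 1.\<close>
lemma card_neighbours_le:
  assumes "p > 0" shows "real (card (neighbours p T)) * return_prob p T \<le> 2"
proof -
  have "real (card (neighbours p T)) * (return_prob p T / 2) \<le> (\<Sum>x\<in>neighbours p T. lazy_prob p T x)"
    by (rule sum_bounded_below) (simp add: neighbours_def)
  also have "\<dots> \<le> (\<Sum>x\<in>{0..<int p}. lazy_prob p T x)"
    by (rule sum_mono2) (auto simp: neighbours_def lazy_prob_nonneg assms)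
  finally show ?thesis using sum_lazy_prob[OF assms, of T] by simp
qed

text \<open>Conditioning on the first step, the walk returns either after standing still or from
  \<open>\<plusminus>x\<close>, and the latter is at most half as likely as usual: \<open>3/4 +
  1/4 \<cdot> 1/2 = 7/8\<close>.\<close>
lemma return_prob_Cons_not_neighbour:
  assumes "x \<in> {0..<int p}" "x \<notin> neighbours p T"
  shows "return_prob p (x # T) \<le> 7 / 8 * return_prob p T"
  using assms by (auto simp: neighbours_def return_prob_Cons)

lemma return_prob_single:
  assumes "p > 0" "\<not> int p dvd a" shows "return_prob p [a] = 3 / 4"
  using assms by (simp add: return_prob_Cons return_prob_Nil lazy_prob_Nil)

section \<open>Powers of the Fourier transform\<close>

lemma card_mod_translate:
  assumes "A \<subseteq> {0..<int p}"
  shows "card ((\<lambda>x. (x - a) mod int p) ` A) = card A"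
proof (rule card_image, rule inj_onI)
  fix x y assume xy: "x \<in> A" "y \<in> A" and "(x - a) mod int p = (y - a) mod int p"
  then have "x mod int p = y mod int p" by (simp add: mod_eq_dvd_iff)
  then show "x = y" using xy assms by (auto simp: subset_iff)
qed

text \<open>The set of frequencies at which the Fourier transform is large grows when differences are taken.
  Quantitatively this rests on the fact that a set with fewer than \<open>3/2\<close> times as
  many differences as elements has a subgroup as its difference set.\<close>
definition mod_diffs :: "nat \<Rightarrow> int set \<Rightarrow> int set" where
  "mod_diffs p A = (\<lambda>(a, b). (a - b) mod int p) ` (A \<times> A)"

lemma mod_diffsI: "a \<in> A \<Longrightarrow> b \<in> A \<Longrightarrow> (a - b) mod int p \<in> mod_diffs p A"
  by (auto simp: mod_diffs_def)

text \<open>If \<open>x = a - b\<close>, then the translates \<open>A - a\<close> and \<open>A - b\<close>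
  both lie in the difference set, so they share more than half of the elements of
  \<open>A\<close>; hence more than half of \<open>A\<close> occurs as the first term of a
  representation of \<open>x\<close> as a difference. Two such halves of \<open>A\<close>, for
  \<open>x\<close> and for \<open>y\<close>, intersect in some \<open>c = d + x = e + y\<close>,
  and then \<open>x - y = e - d\<close>.\<close>
lemma mod_diffs_closed:
  assumes A: "A \<subseteq> {0..<int p}" and small: "2 * card (mod_diffs p A) < 3 * card A"
    and x: "x \<in> mod_diffs p A" and y: "y \<in> mod_diffs p A"
  shows "(x - y) mod int p \<in> mod_diffs p A"
proof -
  have finA: "finite A" using A finite_subset by blast
  then have fin: "finite (mod_diffs p A)" by (simp add: mod_diffs_def)
  define R where "R x = {c \<in> A. \<exists>d\<in>A. c mod int p = (d + x) mod int p}" for x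
  have many: "2 * card (R x) > card A" if x: "x \<in> mod_diffs p A" for x
  proof -
    obtain a b where ab: "a \<in> A" "b \<in> A" "x = (a - b) mod int p"
      using x by (auto simp: mod_diffs_def)
    let ?T = "\<lambda>a. (\<lambda>x. (x - a) mod int p) ` A"
    have "?T a \<subseteq> mod_diffs p A" "?T b \<subseteq> mod_diffs p A" using ab by (auto intro: mod_diffsI)
    then have "card (?T a \<union> ?T b) \<le> card (mod_diffs p A)" by (intro card_mono fin) auto
    moreover have "card (?T a) + card (?T b) = card (?T a \<union> ?T b) + card (?T a \<inter> ?T b)"
      by (rule card_Un_Int) (simp_all add: finA)
    moreover have "?T a \<inter> ?T b \<subseteq> (\<lambda>x. (x - a) mod int p) ` R x"
    proof
      fix z assume "z \<in> ?T a \<inter> ?T b"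
      then obtain c d where cd: "c \<in> A" "d \<in> A" "z = (c - a) mod int p" "z = (d - b) mod int p" by auto
      then have "int p dvd (c - a) - (d - b)" by (metis mod_eq_dvd_iff)
      then have "c mod int p = (d + (a - b)) mod int p" by (simp add: mod_eq_dvd_iff algebra_simps)
      then have "c mod int p = (d + x) mod int p" unfolding ab(3) by (simp add: mod_add_right_eq)
      then show "z \<in> (\<lambda>x. (x - a) mod int p) ` R x" using cd by (auto simp: R_def)
    qed
    then have "card (?T a \<inter> ?T b) \<le> card (R x)"
      by (rule surj_card_le[rotated]) (simp add: R_def finA)
    ultimately show ?thesis using small card_mod_translate[OF A] by simp
  qed
  have "card (R x) + card (R y) = card (R x \<union> R y) + card (R x \<inter> R y)"
    by (rule card_Un_Int) (simp_all add: R_def finA)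
  moreover have "card (R x \<union> R y) \<le> card A" by (rule card_mono[OF finA]) (auto simp: R_def)
  ultimately have "card (R x \<inter> R y) \<noteq> 0" using many[OF x] many[OF y] by linarith
  then obtain c where "c \<in> R x" "c \<in> R y" by (metis card_eq_0_iff disjoint_iff)
  then obtain d e where de: "d \<in> A" "e \<in> A" "(d + x) mod int p = (e + y) mod int p"
    by (auto simp: R_def)
  then have "int p dvd (d + x) - (e + y)" by (simp only: mod_eq_dvd_iff)
  then have "int p dvd (x - y) - (e - d)" by (simp add: algebra_simps)
  then have "(x - y) mod int p = (e - d) mod int p" by (simp only: mod_eq_dvd_iff)
  then show ?thesis using de by (simp add: mod_diffsI)
qed

lemma mod_sub_closed_eq_all:
  assumes p: "prime p" and H: "H \<subseteq> {0..<int p}" and h: "h \<in> H" "h \<noteq> 0"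
    and closed: "\<And>x y. x \<in> H \<Longrightarrow> y \<in> H \<Longrightarrow> (x - y) mod int p \<in> H"
  shows "H = {0..<int p}"
proof -
  have "p > 0" using p by (simp add: prime_gt_0_nat)
  have 0: "0 \<in> H" using closed[OF h(1) h(1)] by simp
  have mult: "(- int k * h) mod int p \<in> H" for k
  proof (induction k)
    case (Suc k)
    have "(- int (Suc k) * h) mod int p = ((- int k * h) mod int p - h) mod int p"
      unfolding mod_diff_left_eq by (rule arg_cong[where f = "\<lambda>z. z mod int p"]) (simp add: algebra_simps)
    then show ?case using closed[OF Suc h(1)] by simp
  qed (use 0 in simp)
  have "\<not> int p dvd h" using h H by (intro zdvd_not_zless) force+
  then have "coprime (int p) h" using p by (intro prime_imp_coprime) auto
  then obtain u where u: "[h * u = 1] (mod int p)"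
    using cong_solve_coprime_int[of h "int p"] by (auto simp: coprime_commute)
  have "x \<in> H" if x: "x \<in> {0..<int p}" for x
  proof -
    define k where "k = nat ((- (u * x)) mod int p)"
    have "(- int k * h) mod int p = (- (((- (u * x)) mod int p) * h)) mod int p"
      using \<open>p > 0\<close> by (simp add: k_def)
    also have "\<dots> = (- ((- (u * x)) * h)) mod int p"
      by (metis mod_minus_eq mod_mult_left_eq)
    also have "\<dots> = (h * u * x) mod int p" by (simp add: mult_ac)
    also have "\<dots> = (1 * x) mod int p"
      using cong_scalar_right[OF u, of x] by (simp add: cong_def)
    also have "\<dots> = x" using x by simp
    finally show ?thesis using mult[of k] by simp
  qed
  then show ?thesis using H by blast
qed

text \<open>Up to a factor 2 this is minus the logarithm of \<open>lazy_char\<close>, but unlike the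
  logarithm it satisfies the simple quasi-triangle inequality \<open>decay_diff\<close> and has an
  explicit mean.\<close>
definition decay :: "nat \<Rightarrow> int list \<Rightarrow> int \<Rightarrow> real" where
  "decay p T t = (\<Sum>a\<leftarrow>T. (1 - phase p a t) / 4)"

lemma decay_Nil [simp]: "decay p [] t = 0"
  and decay_Cons [simp]: "decay p (a # T) t = (1 - phase p a t) / 4 + decay p T t"
  by (simp_all add: decay_def)

lemma decay_at_0: "decay p T 0 = 0"
  by (induction T) auto

lemma decay_mod: "p > 0 \<Longrightarrow> decay p T (t mod int p) = decay p T t"
  by (induction T) (auto simp: phase_mod)

lemma lazy_char_le_exp: "lazy_char p T t \<le> exp (- decay p T t)"
proof (induction T)
  case (Cons a T)
  have "3 / 4 + phase p a t / 4 \<le> exp (- ((1 - phase p a t) / 4))"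
    using exp_ge_add_one_self[of "- ((1 - phase p a t) / 4)"] by simp argo
  then have "lazy_char p (a # T) t \<le> exp (- ((1 - phase p a t) / 4)) * exp (- decay p T t)"
    unfolding lazy_char_Cons using Cons lazy_char_pos[of p T t] by (intro mult_mono) auto
  then show ?case by (simp flip: exp_add)
qed simp

text \<open>Here \<open>y\<close> stands for one summand of \<open>decay\<close>, which lies in this range
  because \<open>lazy_char\<close> has factors at least \<open>1/2\<close>.\<close>
lemma exp_minus_double_le:
  fixes y :: real assumes "0 \<le> y" "y \<le> 1 / 2" shows "exp (- (2 * y)) \<le> 1 - y"
proof -
  have "1 \<le> (1 - y) * (1 + 2 * y)" using assms mult_right_mono[of "2 * y" 1 y] by (simp add: algebra_simps)
  also have "\<dots> \<le> (1 - y) * exp (2 * y)"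
    using assms by (intro mult_left_mono exp_ge_add_one_self) auto
  finally show ?thesis by (simp add: exp_minus field_simps)
qed

lemma exp_le_lazy_char: "exp (- 2 * decay p T t) \<le> lazy_char p T t"
proof (induction T)
  case (Cons a T)
  have "exp (- (2 * ((1 - phase p a t) / 4))) \<le> 1 - (1 - phase p a t) / 4"
    using phase_bounds[of p a t] by (intro exp_minus_double_le) auto
  then have "exp (- (2 * ((1 - phase p a t) / 4))) * exp (- 2 * decay p T t) \<le> lazy_char p (a # T) t"
    unfolding lazy_char_Cons using Cons lazy_factor_bounds[of p a t]
    by (intro mult_mono) (auto simp: diff_divide_distrib)
  also have "exp (- (2 * ((1 - phase p a t) / 4))) * exp (- 2 * decay p T t) = exp (- 2 * decay p (a # T) t)"
    unfolding exp_add[symmetric] by (rule arg_cong[where f = exp]) (simp add: field_simps)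
  finally show ?case .
qed simp

text \<open>Since \<open>1 - cos (2z) = 2 sin\<^sup>2 z\<close>, this is subadditivity of
  \<open>\<bar>sin\<bar>\<close> followed by squaring.\<close>
lemma one_minus_phase_diff: "1 - phase p a (s - t) \<le> 2 * (1 - phase p a s) + 2 * (1 - phase p a t)"
proof -
  define x y where "x = pi * of_int (a * s) / real p" and "y = pi * of_int (a * t) / real p"
  have sq: "1 - cos (2 * z) = 2 * (sin z)\<^sup>2" for z :: real
    by (simp add: cos_double_sin)
  have e: "2 * pi * of_int (a * s) / real p = 2 * x" "2 * pi * of_int (a * t) / real p = 2 * y"
    "2 * pi * of_int (a * (s - t)) / real p = 2 * (x - y)"
    by (simp_all add: x_def y_def algebra_simps diff_divide_distrib)
  have "\<bar>sin (x - y)\<bar> \<le> \<bar>sin x\<bar> + \<bar>sin y\<bar>"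
  proof -
    have "\<bar>sin (x - y)\<bar> \<le> \<bar>sin x * cos y\<bar> + \<bar>cos x * sin y\<bar>" by (simp add: sin_diff)
    also have "\<dots> \<le> \<bar>sin x\<bar> + \<bar>sin y\<bar>"
      unfolding abs_mult by (intro add_mono mult_left_le mult_left_le_one_le) auto
    finally show ?thesis .
  qed
  then have "\<bar>sin (x - y)\<bar>\<^sup>2 \<le> (\<bar>sin x\<bar> + \<bar>sin y\<bar>)\<^sup>2"
    by (intro power_mono) auto
  also have "\<dots> \<le> 2 * (sin x)\<^sup>2 + 2 * (sin y)\<^sup>2"
    using sum_squares_bound[of "\<bar>sin x\<bar>" "\<bar>sin y\<bar>"] by (simp add: power2_sum)
  finally show ?thesis unfolding phase_def e sq by simp
qed

lemma decay_diff: "decay p T (s - t) \<le> 2 * decay p T s + 2 * decay p T t"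
proof (induction T)
  case (Cons a T)
  then show ?case using one_minus_phase_diff[of p a s t] by (simp add: field_simps)
qed simp

lemma sum_decay:
  assumes "p > 0" "\<And>a. a \<in> set T \<Longrightarrow> \<not> int p dvd a"
  shows "(\<Sum>t\<in>{0..<int p}. decay p T t) = real p * real (length T) / 4"
  using assms(2)
proof (induction T)
  case (Cons a T)
  have "(\<Sum>t\<in>{0..<int p}. decay p (a # T) t)
      = (real p - (\<Sum>t\<in>{0..<int p}. phase p a t)) / 4 + (\<Sum>t\<in>{0..<int p}. decay p T t)"
    by (simp add: sum.distrib sum_subtractf flip: sum_divide_distrib)
  then show ?case using Cons by (simp add: sum_phase[OF assms(1)] algebra_simps)
qed simp

definition low_decay :: "nat \<Rightarrow> int list \<Rightarrow> real \<Rightarrow> int set" where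
  "low_decay p T s = {t \<in> {0..<int p}. decay p T t \<le> s}"

lemma finite_low_decay [simp]: "finite (low_decay p T s)"
  by (rule finite_subset[of _ "{0..<int p}"]) (auto simp: low_decay_def)

text \<open>By \<open>decay_diff\<close>, differences of frequencies with decay at most \<open>s\<close>
  have decay at most \<open>4s\<close>. If there were fewer than \<open>3/2\<close> times as many
  of them, they would form a nonzero subgroup, hence consist of all residues; this is impossible
  because the mean of the decay is at least \<open>1/4\<close>.\<close>
lemma card_low_decay_growth:
  assumes p: "prime p" and T: "T \<noteq> []" "\<And>a. a \<in> set T \<Longrightarrow> \<not> int p dvd a"
    and s: "0 \<le> s" "4 * s < 1 / 4" and two: "card (low_decay p T s) \<ge> 2"
  shows "3 * card (low_decay p T s) \<le> 2 * card (low_decay p T (4 * s))"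
proof (rule ccontr)
  assume neg: "\<not> ?thesis"
  let ?A = "low_decay p T s" and ?B = "low_decay p T (4 * s)"
  have p0: "p > 0" using p by (simp add: prime_gt_0_nat)
  have A: "?A \<subseteq> {0..<int p}" by (auto simp: low_decay_def)
  have sub: "mod_diffs p ?A \<subseteq> ?B"
  proof
    fix z assume "z \<in> mod_diffs p ?A"
    then obtain a b where ab: "a \<in> ?A" "b \<in> ?A" "z = (a - b) mod int p" by (auto simp: mod_diffs_def)
    then show "z \<in> ?B" using decay_diff[of p T a b] p0 by (auto simp: low_decay_def decay_mod)
  qed
  have z: "0 \<in> ?A" using s p0 by (simp add: low_decay_def decay_at_0)
  have "?A \<noteq> {0}" using two by (metis card_1_singleton_iff Suc_1 not_less_eq_eq le_refl One_nat_def)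
  then obtain h where h: "h \<in> ?A" "h \<noteq> 0" using z by blast
  have "card (mod_diffs p ?A) \<le> card ?B" by (rule card_mono[OF _ sub]) simp
  then have small: "2 * card (mod_diffs p ?A) < 3 * card ?A" using neg by linarith
  have "h \<in> mod_diffs p ?A" 
  proof -
    have "0 \<le> h" "h < int p" using h(1) by (simp_all add: low_decay_def)
    then show ?thesis using mod_diffsI[OF h(1) z, of p] by simp
  qed
  moreover have "mod_diffs p ?A \<subseteq> {0..<int p}" using p0 by (auto simp: mod_diffs_def)
  ultimately have "mod_diffs p ?A = {0..<int p}"
    using h(2) by (intro mod_sub_closed_eq_all[OF p] mod_diffs_closed[OF A small])
  then have "decay p T t \<le> 4 * s" if "t \<in> {0..<int p}" for t using sub that by (auto simp: low_decay_def)
  then have "(\<Sum>t\<in>{0..<int p}. decay p T t) \<le> real p * (4 * s)"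
    using sum_bounded_above[of "{0..<int p}" "decay p T" "4 * s"] by simp
  moreover have "real p * (4 * s) < real p * (1 / 4)" using s p0 by (intro mult_strict_left_mono) auto
  moreover have "real p * (1 / 4) \<le> real p * real (length T) / 4"
    using T(1) by (cases T) (auto simp: field_simps)
  ultimately show False using sum_decay[OF p0 T(2)] by simp
qed

text \<open>The summand 1 accounts for level sets that contain nothing but the frequency \<open>0\<close>,
  which do not grow.\<close>
lemma card_low_decay_iterate:
  assumes p: "prime p" and T: "T \<noteq> []" "\<And>a. a \<in> set T \<Longrightarrow> \<not> int p dvd a"
    and s: "0 \<le> s" "s < 1 / 4"
  shows "real (card (low_decay p T (s / 4 ^ J))) \<le> 1 + (2 / 3) ^ J * real (card (low_decay p T s))"
proof (cases "card (low_decay p T (s / 4 ^ J)) \<ge> 2")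
  case True
  have "real (card (low_decay p T (s / 4 ^ J))) \<le> (2 / 3) ^ J * real (card (low_decay p T s))"
    using True
  proof (induction J)
    case (Suc J)
    have eq: "4 * (s / 4 ^ Suc J) = s / 4 ^ J" by simp
    have "s / 4 ^ J \<le> s / 1" using s by (intro divide_left_mono) auto
    then have lt: "4 * (s / 4 ^ Suc J) < 1 / 4"
      unfolding eq using s by linarith
    have grow: "3 * card (low_decay p T (s / 4 ^ Suc J)) \<le> 2 * card (low_decay p T (s / 4 ^ J))"
      using card_low_decay_growth[OF p T _ lt Suc.prems] s unfolding eq by simp
    then have "card (low_decay p T (s / 4 ^ J)) \<ge> 2" using Suc.prems by linarith
    then have "real (card (low_decay p T (s / 4 ^ J))) \<le> (2 / 3) ^ J * real (card (low_decay p T s))"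
      by (rule Suc.IH)
    then show ?case using grow by simp
  qed simp
  then show ?thesis by simp
next
  case False
  then have "real (card (low_decay p T (s / 4 ^ J))) \<le> 1" by simp
  also have "\<dots> \<le> 1 + (2 / 3) ^ J * real (card (low_decay p T s))" by simp
  finally show ?thesis .
qed

lemma exp_minus_le_inverse: "x > 0 \<Longrightarrow> exp (- x) \<le> 1 / (x :: real)"
proof -
  assume "x > 0"
  moreover have "x \<le> exp x" using exp_ge_add_one_self[of x] by linarith
  ultimately show ?thesis by (simp add: exp_minus inverse_eq_divide frac_le)
qed

text \<open>The \<open>k\<close>-th power with \<open>k = 16^J\<close> kills all frequencies except those
  with decay below \<open>4^J/k\<close>, up to a constant, and by
  \<open>card_low_decay_iterate\<close> these are by a factor \<open>(2/3)^J\<close> fewer than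
  those with decay below a constant, each of which contributes a constant to the sum of
  \<open>lazy_char\<close>.\<close>
lemma sum_lazy_char_power_le:
  assumes p: "prime p" and T: "T \<noteq> []" "\<And>a. a \<in> set T \<Longrightarrow> \<not> int p dvd a"
  shows "(\<Sum>t\<in>{0..<int p}. lazy_char p T t ^ 16 ^ J)
    \<le> 1 + 34 * (2 / 3) ^ J * (\<Sum>t\<in>{0..<int p}. lazy_char p T t)"
proof -
  define k :: nat where "k = 16 ^ J"
  have k1: "k \<ge> 1" by (simp add: k_def)
  \<comment> \<open>The growth lemma applies up to level \<open>1/16\<close>, so that the iteration may end at any level below \<open>1/4\<close>.\<close>
  define s :: real where "s = 1 / 8"
  define s' where "s' = s / 4 ^ J"
  let ?F = "lazy_char p T" and ?D = "decay p T" and ?Z = "low_decay p T"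
  define \<Sigma> where "\<Sigma> = (\<Sum>t\<in>{0..<int p}. ?F t)"
  have \<Sigma>0: "\<Sigma> \<ge> 0" by (simp add: \<Sigma>_def sum_nonneg less_imp_le lazy_char_pos)
  have F: "0 \<le> ?F t" "?F t \<le> 1" for t by (simp_all add: lazy_char_pos less_imp_le lazy_char_le_1)
  have Fj: "?F t ^ j \<le> exp (- (real j * r))" if "r \<le> ?D t" for t j r
  proof -
    have "?F t ^ j \<le> exp (- ?D t) ^ j" by (intro power_mono lazy_char_le_exp F)
    also have "\<dots> = exp (- (real j * ?D t))" by (simp flip: exp_of_nat_mult)
    also have "\<dots> \<le> exp (- (real j * r))" using that by (simp add: mult_left_mono)
    finally show ?thesis .
  qed
  have pointwise: "?F t ^ k \<le> indicator (?Z s') t + exp (- (real k * s')) * indicator (?Z s) t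
      + exp (- (real (k - 1) * s)) * ?F t" if t: "t \<in> {0..<int p}" for t
  proof -
    consider "?D t \<le> s'" | "s' < ?D t" "?D t \<le> s" | "s < ?D t" by linarith
    then show ?thesis
    proof cases
      case 1
      then have "indicator (?Z s') t = (1::real)" using t by (simp add: low_decay_def)
      moreover have "?F t ^ k \<le> 1" using F by (simp add: power_le_one)
      ultimately show ?thesis using F by (simp add: add_increasing2)
    next
      case 2
      then have "indicator (?Z s) t = (1::real)" using t by (simp add: low_decay_def)
      then show ?thesis using Fj[of s' t k] 2 F by (simp add: add_increasing2 add_increasing)
    next
      case 3
      have "?F t ^ k = ?F t ^ (k - 1) * ?F t" using k1 by (simp flip: power_Suc2)
      also have "\<dots> \<le> exp (- (real (k - 1) * s)) * ?F t"
        using 3 by (intro mult_right_mono Fj F) auto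
      finally show ?thesis using F by (simp add: add_increasing)
    qed
  qed
  have card_Z: "(\<Sum>t\<in>{0..<int p}. indicator (?Z r) t) = real (card (?Z r))" for r
    by (simp add: indicator_def sum.If_cases low_decay_def Int_def)
  have "(\<Sum>t\<in>{0..<int p}. ?F t ^ k) \<le> (\<Sum>t\<in>{0..<int p}. indicator (?Z s') t
      + exp (- (real k * s')) * indicator (?Z s) t + exp (- (real (k - 1) * s)) * ?F t)"
    by (rule sum_mono) (rule pointwise)
  also have "\<dots> = real (card (?Z s')) + exp (- (real k * s')) * real (card (?Z s))
      + exp (- (real (k - 1) * s)) * \<Sigma>"
    by (simp add: sum.distrib card_Z \<Sigma>_def flip: sum_distrib_left)
  also have "real (card (?Z s')) \<le> 1 + (2 / 3) ^ J * real (card (?Z s))"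
    unfolding s'_def by (rule card_low_decay_iterate[OF p T]) (auto simp: s_def)
  also have "exp (- (real k * s')) \<le> 8 * (2 / 3) ^ J"
  proof -
    have "real k * s' = 4 ^ J / 8"
      by (simp add: k_def s'_def s_def flip: power_mult_distrib power_divide)
    then have "exp (- (real k * s')) = exp (- (4 ^ J / 8))" by (simp only:)
    also have "\<dots> \<le> 1 / (4 ^ J / 8)" by (rule exp_minus_le_inverse) simp
    also have "\<dots> = 8 * (1 / 4) ^ J" by (simp add: power_one_over)
    also have "\<dots> \<le> 8 * (2 / 3) ^ J" by (intro mult_left_mono power_mono) auto
    finally show ?thesis .
  qed
  also have "exp (- (real (k - 1) * s)) \<le> 16 * (2 / 3) ^ J"
  proof -
    have "exp (- (real (k - 1) * s)) = exp (1 / 8) * exp (- (real k / 8))"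
      using k1 by (simp add: s_def of_nat_diff field_simps flip: exp_add)
    also have "\<dots> \<le> 2 * (1 / (real k / 8))"
      using k1 exp_bound[of "1 / 8"] 
      by (intro mult_mono exp_minus_le_inverse) (auto simp: power2_eq_square)
    also have "\<dots> = 16 * (1 / 16) ^ J" by (simp add: k_def power_one_over)
    also have "\<dots> \<le> 16 * (2 / 3) ^ J" by (intro mult_left_mono power_mono) auto
    finally show ?thesis .
  qed
  finally have *: "(\<Sum>t\<in>{0..<int p}. ?F t ^ k) \<le>
      1 + (2 / 3) ^ J * real (card (?Z s)) + 8 * (2 / 3) ^ J * real (card (?Z s)) + 16 * (2 / 3) ^ J * \<Sigma>"
    using \<Sigma>0 by (simp add: mult_right_mono)
  have "real (card (?Z s)) * (1 / 2) \<le> (\<Sum>t\<in>?Z s. ?F t)"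
  proof (rule sum_bounded_below)
    fix t assume t: "t \<in> ?Z s"
    have "1 / 2 \<le> 1 - (1 / 4 :: real)" by simp
    also have "\<dots> \<le> exp (- 2 * ?D t)"
      using exp_ge_add_one_self[of "- 2 * ?D t"] t by (simp add: low_decay_def s_def)
    also have "\<dots> \<le> ?F t" by (rule exp_le_lazy_char)
    finally show "1 / 2 \<le> ?F t" .
  qed
  also have "\<dots> \<le> \<Sigma>" unfolding \<Sigma>_def by (rule sum_mono2) (auto simp: low_decay_def F)
  finally have "(2 / 3) ^ J * real (card (?Z s)) \<le> (2 / 3) ^ J * (2 * \<Sigma>)"
    by (intro mult_left_mono) auto
  with * have "(\<Sum>t\<in>{0..<int p}. ?F t ^ k) \<le> 1 + 34 * (2 / 3) ^ J * \<Sigma>"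
    unfolding mult.assoc mult.left_commute[of _ 2 \<Sigma>] by linarith
  then show ?thesis by (simp add: k_def \<Sigma>_def)
qed

text \<open>The inequality of arithmetic and geometric means, for the numbers \<open>x j ^ k\<close>.\<close>
lemma prod_le_mean_power:
  fixes x :: "nat \<Rightarrow> real"
  assumes "k > 0" "\<And>j. j < k \<Longrightarrow> 0 \<le> x j"
  shows "(\<Prod>j<k. x j) \<le> (\<Sum>j<k. x j ^ k) / real k"
proof -
  define P where "P = (\<Prod>j<k. x j)"
  have "(\<Prod>j<k. x j ^ k) powr (1 / card {..<k}) \<le> (\<Sum>j<k. x j ^ k / card {..<k})"
    using assms by (intro arith_geom_mean) auto
  then have "(P ^ k) powr (1 / k) \<le> (\<Sum>j<k. x j ^ k) / real k"
    by (simp add: P_def sum_divide_distrib flip: prod_power_distrib)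
  moreover have "(P ^ k) powr (1 / k) = P"
  proof (cases "P = 0")
    case False
    then have "P > 0" using assms(2) by (auto simp: P_def intro!: prod_pos order.not_eq_order_implies_strict)
    then show ?thesis using assms(1) by (simp add: powr_powr flip: powr_realpow)
  qed (use assms(1) in simp)
  ultimately show ?thesis by (simp add: P_def)
qed

text \<open>The product of \<open>k\<close> transforms is at most the mean of their \<open>k\<close>-th
  powers, so this follows from the bound for a single \<open>k\<close>-th power.\<close>
lemma exists_return_prob_of_product_le:
  fixes T :: "nat \<Rightarrow> int list"
  assumes p: "prime p"
    and T: "\<And>j. j < 16 ^ J \<Longrightarrow> T j \<noteq> []" "\<And>j a. j < 16 ^ J \<Longrightarrow> a \<in> set (T j) \<Longrightarrow> \<not> int p dvd a"
  shows "\<exists>j<16 ^ J. (\<Sum>t\<in>{0..<int p}. \<Prod>j<16 ^ J. lazy_char p (T j) t) / real p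
    \<le> 1 / real p + 34 * (2 / 3) ^ J * return_prob p (T j)"
proof -
  define k :: nat where "k = 16 ^ J"
  have k: "k > 0" by (simp add: k_def)
  obtain i where i: "i < k" "\<And>j. j < k \<Longrightarrow> return_prob p (T j) \<le> return_prob p (T i)"
  proof -
    have "Max ((\<lambda>j. return_prob p (T j)) ` {..<k}) \<in> (\<lambda>j. return_prob p (T j)) ` {..<k}"
      using k by (intro Max_in) auto
    then obtain i where "i < k" "return_prob p (T i) = Max ((\<lambda>j. return_prob p (T j)) ` {..<k})" by auto
    then show ?thesis using that by simp
  qed
  have "(\<Sum>t\<in>{0..<int p}. \<Prod>j<k. lazy_char p (T j) t)
      \<le> (\<Sum>t\<in>{0..<int p}. (\<Sum>j<k. lazy_char p (T j) t ^ k) / real k)"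
    by (intro sum_mono prod_le_mean_power k) (simp add: less_imp_le lazy_char_pos)
  also have "\<dots> = (\<Sum>j<k. \<Sum>t\<in>{0..<int p}. lazy_char p (T j) t ^ k) / real k"
    unfolding sum_divide_distrib[symmetric] by (subst sum.swap) simp
  also have "\<dots> \<le> (\<Sum>j<k. 1 + 34 * (2 / 3) ^ J * (real p * return_prob p (T i))) / real k"
  proof (intro divide_right_mono sum_mono)
    fix j assume "j \<in> {..<k}"
    then have j: "j < k" by simp
    have "(\<Sum>t\<in>{0..<int p}. lazy_char p (T j) t ^ k)
        \<le> 1 + 34 * (2 / 3) ^ J * (\<Sum>t\<in>{0..<int p}. lazy_char p (T j) t)"
      unfolding k_def using j by (intro sum_lazy_char_power_le p T) (auto simp: k_def)
    also have "(\<Sum>t\<in>{0..<int p}. lazy_char p (T j) t) = real p * return_prob p (T j)"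
      using p by (simp add: return_prob_def prime_gt_0_nat)
    also have "\<dots> \<le> real p * return_prob p (T i)" using i(2)[OF j] by (intro mult_left_mono) auto
    finally show "(\<Sum>t\<in>{0..<int p}. lazy_char p (T j) t ^ k)
        \<le> 1 + 34 * (2 / 3) ^ J * (real p * return_prob p (T i))" by (simp add: mult_left_mono)
  qed auto
  also have "\<dots> = 1 + 34 * (2 / 3) ^ J * (real p * return_prob p (T i))" using k by simp
  finally have "(\<Sum>t\<in>{0..<int p}. \<Prod>j<k. lazy_char p (T j) t) / real p
      \<le> (1 + 34 * (2 / 3) ^ J * (real p * return_prob p (T i))) / real p"
    by (intro divide_right_mono) auto
  also have "\<dots> = 1 / real p + 34 * (2 / 3) ^ J * return_prob p (T i)"
    using p by (simp add: add_divide_distrib prime_gt_0_nat)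
  finally show ?thesis using i(1) unfolding k_def by blast
qed

section \<open>Replacing random signs by lazy steps\<close>

abbreviation sign_pmf :: "int pmf" where
  "sign_pmf \<equiv> pmf_of_set {-1, 1}"

lemma prob_bind_pmf:
  "measure_pmf.prob (bind_pmf M N) X = measure_pmf.expectation M (\<lambda>x. measure_pmf.prob (N x) X)"
proof -
  have "ennreal (measure_pmf.prob (bind_pmf M N) X) = (\<integral>\<^sup>+x. ennreal (measure_pmf.prob (N x) X) \<partial>M)"
    by (simp flip: measure_pmf.emeasure_eq_measure)
  also have "\<dots> = ennreal (measure_pmf.expectation M (\<lambda>x. measure_pmf.prob (N x) X))"
    by (intro nn_integral_eq_integral measure_pmf.integrable_const_bound[where B = 1]) auto
  finally show ?thesis by (subst (asm) ennreal_inj) auto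
qed

lemma prob_pair_pmf_le:
  assumes "measure_pmf.prob A {f. R f} \<le> a" "\<And>f. measure_pmf.prob B {g. S f g} \<le> b" "0 \<le> b"
  shows "measure_pmf.prob (pair_pmf A B) {(f, g). R f \<and> S f g} \<le> a * b"
proof -
  have "measure_pmf.prob (pair_pmf A B) {(f, g). R f \<and> S f g}
      = measure_pmf.expectation A (\<lambda>f. measure_pmf.prob B {g. R f \<and> S f g})"
    unfolding pair_pmf_def by (simp add: prob_bind_pmf flip: map_pmf_def)
  also have "\<dots> \<le> measure_pmf.expectation A (\<lambda>f. b * indicator {f. R f} f)"
    by (intro integral_mono measure_pmf.integrable_const_bound[where B = 1]
        measure_pmf.integrable_const_bound[where B = b])
      (auto simp: assms indicator_def)
  also have "\<dots> \<le> a * b"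
    using mult_left_mono[OF assms(1,3)] by (simp add: mult.commute)
  finally show ?thesis .
qed

text \<open>The Fourier transform of a random sign times \<open>a\<close> is a cosine, so this is Fourier
  inversion; it is proved by conditioning on one sign at a time.\<close>
lemma sign_sum_prob_Fourier:
  assumes "p > 0" "distinct xs"
  shows "measure_pmf.prob (Pi_pmf (set xs) 0 (\<lambda>_. sign_pmf)) {\<epsilon>. int p dvd (\<Sum>i\<in>set xs. \<epsilon> i * v i) - c}
    = (\<Sum>t\<in>{0..<int p}. (\<Prod>i\<leftarrow>xs. phase p (v i) t) * phase p c t) / real p"
  using assms(2)
proof (induction xs arbitrary: c)
  case Nil
  show ?case
    using sum_phase[OF assms(1), of c] assms(1) by (simp add: indicator_def)
next
  case (Cons x xs)
  let ?Q = "Pi_pmf (set xs) 0 (\<lambda>_. sign_pmf)"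
  let ?E = "\<lambda>c. {\<epsilon>. int p dvd (\<Sum>i\<in>set xs. \<epsilon> i * v i) - c}"
  let ?S = "{\<epsilon>. int p dvd (\<Sum>i\<in>set (x # xs). \<epsilon> i * v i) - c}"
  have x: "x \<notin> set xs" and d: "distinct xs" using Cons.prems by auto
  have upd: "(\<lambda>f. f(x := y)) -` ?S = ?E (c - y * v x)" for y
  proof -
    have "(\<Sum>i\<in>set xs. (f(x := y)) i * v i) = (\<Sum>i\<in>set xs. f i * v i)" for f
      by (rule sum.cong) (use x in auto)
    then show ?thesis using x by (auto simp: algebra_simps)
  qed
  have "measure_pmf.prob (Pi_pmf (set (x # xs)) 0 (\<lambda>_. sign_pmf)) ?S
      = measure_pmf.expectation sign_pmf (\<lambda>y. measure_pmf.prob ?Q (?E (c - y * v x)))"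
    using x upd by (simp add: Pi_pmf_insert' prob_bind_pmf flip: map_pmf_def)
  also have "\<dots> = (measure_pmf.prob ?Q (?E (c + v x)) + measure_pmf.prob ?Q (?E (c - v x))) / 2"
    by (subst integral_pmf_of_set) auto
  also have "\<dots> = (\<Sum>t\<in>{0..<int p}. (\<Prod>i\<leftarrow>xs. phase p (v i) t) *
      (phase p (c - v x) t + phase p (c + v x) t) / 2) / real p"
    unfolding Cons.IH[OF d]
    by (simp add: distrib_left sum.distrib add_divide_distrib sum_divide_distrib mult.commute)
  also have "\<dots> = (\<Sum>t\<in>{0..<int p}. (\<Prod>i\<leftarrow>x # xs. phase p (v i) t) * phase p c t) / real p"
    unfolding phase_add_minus by (simp add: mult_ac)
  finally show ?case .
qed

text \<open>With \<open>y = \<bar>phase p a t\<bar>\<close> this says \<open>y \<le> (1 + y\<^sup>2) /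
  2\<close>.\<close>
lemma abs_phase_le: "\<bar>phase p a t\<bar> \<le> 3 / 4 + phase p a (2 * t) / 4"
proof -
  define y where "y = 2 * pi * of_int (a * t) / real p"
  have "2 * pi * of_int (a * (2 * t)) / real p = 2 * y"
    by (simp add: y_def)
  then have *: "phase p a (2 * t) = 2 * (phase p a t)\<^sup>2 - 1"
    unfolding phase_def by (simp only: cos_double_cos flip: y_def)
  have "0 \<le> (\<bar>phase p a t\<bar> - 1)\<^sup>2" by simp
  then have "2 * \<bar>phase p a t\<bar> \<le> 1 + (phase p a t)\<^sup>2"
    by (simp add: power2_eq_square algebra_simps flip: abs_mult)
  then show ?thesis unfolding * by argo
qed

lemma bij_betw_double_mod:
  assumes "odd p"
  shows "bij_betw (\<lambda>t. 2 * t mod int p) {0..<int p} {0..<int p}"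
proof -
  have p: "p > 0" using assms by (auto intro!: Nat.gr0I)
  have "inj_on (\<lambda>t. 2 * t mod int p) {0..<int p}"
  proof (rule inj_onI)
    fix s t assume s: "s \<in> {0..<int p}" and t: "t \<in> {0..<int p}" and "2 * s mod int p = 2 * t mod int p"
    then have "int p dvd 2 * (s - t)" by (simp add: mod_eq_dvd_iff algebra_simps)
    moreover have "coprime (int p) 2" using assms by simp
    ultimately have "int p dvd s - t" using coprime_dvd_mult_right_iff by blast
    then have "s mod int p = t mod int p" by (simp add: mod_eq_dvd_iff)
    then show "s = t" using s t by simp
  qed
  moreover have "(\<lambda>t. 2 * t mod int p) ` {0..<int p} \<subseteq> {0..<int p}" using p by auto
  ultimately show ?thesis
    by (simp add: bij_betw_def endo_inj_surj)
qed

text \<open>The transform of the signed sum at \<open>t\<close> is dominated by that of the lazy walk at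
  \<open>2t\<close>, and doubling permutes the frequencies.\<close>
lemma sign_sum_prob_le:
  assumes "odd p" "distinct xs"
  shows "measure_pmf.prob (Pi_pmf (set xs) 0 (\<lambda>_. sign_pmf)) {\<epsilon>. int p dvd (\<Sum>i\<in>set xs. \<epsilon> i * v i) - c}
    \<le> return_prob p (map v xs)"
proof -
  have p: "p > 0" using assms by (auto intro!: Nat.gr0I)
  have le: "\<bar>\<Prod>i\<leftarrow>xs. phase p (v i) t\<bar> \<le> lazy_char p (map v xs) (2 * t)" for t
  proof (induction xs)
    case (Cons x xs)
    then show ?case
      using mult_mono[OF abs_phase_le[of p "v x" t] Cons] lazy_factor_bounds(1)[of p "v x" "2 * t"]
      by (simp add: abs_mult)
  qed simp
  have "(\<Sum>t\<in>{0..<int p}. (\<Prod>i\<leftarrow>xs. phase p (v i) t) * phase p c t)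
      \<le> (\<Sum>t\<in>{0..<int p}. lazy_char p (map v xs) (2 * t mod int p))"
  proof (rule sum_mono)
    fix t
    have "(\<Prod>i\<leftarrow>xs. phase p (v i) t) * phase p c t \<le> \<bar>\<Prod>i\<leftarrow>xs. phase p (v i) t\<bar> * \<bar>phase p c t\<bar>"
      by (metis abs_ge_self abs_mult)
    also have "\<dots> \<le> \<bar>\<Prod>i\<leftarrow>xs. phase p (v i) t\<bar> * 1"
      using phase_bounds[of p c t] by (intro mult_left_mono) auto
    also have "\<dots> \<le> lazy_char p (map v xs) (2 * t mod int p)"
      using le[of t] p by (simp add: lazy_char_mod)
    finally show "(\<Prod>i\<leftarrow>xs. phase p (v i) t) * phase p c t \<le> lazy_char p (map v xs) (2 * t mod int p)" .
  qed
  also have "\<dots> = (\<Sum>t\<in>{0..<int p}. lazy_char p (map v xs) t)"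
    by (rule sum.reindex_bij_betw[OF bij_betw_double_mod[OF assms(1)]])
  finally show ?thesis
    unfolding sign_sum_prob_Fourier[OF p assms(2)] return_prob_def
    by (intro divide_right_mono) auto
qed

text \<open>Indexing the entries of a symmetric matrix by the unordered pair of their row and column makes
  them independent and the matrix symmetric by construction.\<close>
definition edges :: "nat set \<Rightarrow> nat set set" where
  "edges I = (\<lambda>(i, j). {i, j}) ` (I \<times> I)"

lemma finite_edges: "finite I \<Longrightarrow> finite (edges I)"
  by (simp add: edges_def)

lemma in_edges: "i \<in> I \<Longrightarrow> j \<in> I \<Longrightarrow> {i, j} \<in> edges I"
  by (auto simp: edges_def)

lemma edges_insert: "edges (insert x I) = (\<lambda>j. {x, j}) ` insert x I \<union> edges I"
  by (fastforce simp: edges_def image_iff insert_commute)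

lemma row_prob_le:
  assumes "odd p" "distinct xs"
  shows "measure_pmf.prob (Pi_pmf ((\<lambda>j. {x, j}) ` set xs) 0 (\<lambda>_. sign_pmf))
      {\<epsilon>. int p dvd (\<Sum>j\<in>set xs. \<epsilon> {x, j} * v j) - c} \<le> return_prob p (map v xs)"
proof -
  let ?e = "\<lambda>j. {x, j}"
  have inj: "inj_on ?e (set xs)" by (auto simp: inj_on_def doubleton_eq_iff)
  define v' where "v' = v \<circ> inv_into (set xs) ?e"
  have v': "v' {x, j} = v j" if "j \<in> set xs" for j
    using inv_into_f_f[OF inj that] by (simp add: v'_def)
  have "(\<Sum>e\<in>?e ` set xs. \<epsilon> e * v' e) = (\<Sum>j\<in>set xs. \<epsilon> {x, j} * v j)" for \<epsilon>
    by (subst sum.reindex[OF inj]) (auto simp: v' intro!: sum.cong)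
  moreover have "map (v' \<circ> ?e) xs = map v xs" by (simp add: v')
  moreover have "distinct (map ?e xs)" using assms inj by (simp add: distinct_map)
  ultimately show ?thesis
    using sign_sum_prob_le[OF assms(1), of "map ?e xs" v' c] by (simp del: map_eq_conv)
qed

text \<open>Induction on the list of indices. The entries in row and column \<open>x\<close> are independent
  of the minor on the remaining indices. Given the former, the conditions on the other rows are
  conditions on that minor with shifted right-hand sides, and the condition on row
  \<open>x\<close> involves the former only.\<close>
lemma symmetric_rows_prob_le:
  assumes "odd p" "distinct xs"
  shows "measure_pmf.prob (Pi_pmf (edges (set xs)) 0 (\<lambda>_. sign_pmf))
      {\<epsilon>. \<forall>i\<in>set xs. int p dvd (\<Sum>j\<in>set xs. \<epsilon> {i, j} * v j) - c i}
    \<le> (\<Prod>k<length xs. return_prob p (drop k (map v xs)))"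
  using assms(2)
proof (induction xs arbitrary: c)
  case (Cons x xs)
  have x: "x \<notin> set xs" and d: "distinct xs" using Cons.prems by auto
  have p: "p > 0" using assms by (auto intro!: Nat.gr0I)
  let ?R = "(\<lambda>j. {x, j}) ` set (x # xs)"
  let ?A = "Pi_pmf ?R 0 (\<lambda>_. sign_pmf)" and ?B = "Pi_pmf (edges (set xs)) 0 (\<lambda>_. sign_pmf)"
  let ?S = "{\<epsilon>. \<forall>i\<in>set (x # xs). int p dvd (\<Sum>j\<in>set (x # xs). \<epsilon> {i, j} * v j) - c i}"
  let ?row = "\<lambda>f. int p dvd (\<Sum>j\<in>set (x # xs). f {x, j} * v j) - c x"
  let ?rest = "\<lambda>f g. \<forall>i\<in>set xs. int p dvd (\<Sum>j\<in>set xs. g {i, j} * v j) - (c i - f {x, i} * v x)"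
  let ?m = "\<lambda>(f, g) e. if e \<in> ?R then f e else g e :: int"
  have disj: "?R \<inter> edges (set xs) = {}"
    using x by (auto simp: edges_def doubleton_eq_iff)
  have "edges (set (x # xs)) = ?R \<union> edges (set xs)"
    using edges_insert[of x "set xs"] by (simp only: list.set)
  then have split: "Pi_pmf (edges (set (x # xs))) 0 (\<lambda>_. sign_pmf) = map_pmf ?m (pair_pmf ?A ?B)"
    using Pi_pmf_union[OF _ _ disj, of 0 "\<lambda>_. sign_pmf"] by (simp only: finite_edges finite_set finite_imageI)
  have "?m -` ?S \<subseteq> {(f, g). ?row f \<and> ?rest f g}"
  proof
    fix z assume "z \<in> ?m -` ?S"
    then obtain f g where z: "z = (f, g)" and fg: "(f, g) \<in> ?m -` ?S" by (cases z) blast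
    have "int p dvd (\<Sum>j\<in>set (x # xs). ?m (f, g) {x, j} * v j) - c x"
      using fg by auto
    also have "(\<Sum>j\<in>set (x # xs). ?m (f, g) {x, j} * v j) = (\<Sum>j\<in>set (x # xs). f {x, j} * v j)"
      by (rule sum.cong) auto
    finally have row: "?row f" .
    have "?rest f g"
    proof
      fix i assume i: "i \<in> set xs"
      have "int p dvd (\<Sum>j\<in>set (x # xs). ?m (f, g) {i, j} * v j) - c i"
        using fg i by auto
      also have "(\<Sum>j\<in>set (x # xs). ?m (f, g) {i, j} * v j)
          = ?m (f, g) {i, x} * v x + (\<Sum>j\<in>set xs. ?m (f, g) {i, j} * v j)"
        using x by simp
      also have "(\<Sum>j\<in>set xs. ?m (f, g) {i, j} * v j) = (\<Sum>j\<in>set xs. g {i, j} * v j)"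
        using x i by (intro sum.cong) (auto simp: doubleton_eq_iff)
      also have "?m (f, g) {i, x} = f {x, i}"
        using i by (auto simp: insert_commute)
      finally show "int p dvd (\<Sum>j\<in>set xs. g {i, j} * v j) - (c i - f {x, i} * v x)"
        by (simp add: algebra_simps)
    qed
    with row show "z \<in> {(f, g). ?row f \<and> ?rest f g}" unfolding z by blast
  qed
  then have "measure_pmf.prob (pair_pmf ?A ?B) (?m -` ?S)
      \<le> measure_pmf.prob (pair_pmf ?A ?B) {(f, g). ?row f \<and> ?rest f g}"
    by (intro measure_pmf.finite_measure_mono) auto
  also have "\<dots> \<le> return_prob p (map v (x # xs)) * (\<Prod>k<length xs. return_prob p (drop k (map v xs)))"
  proof (rule prob_pair_pmf_le[where R = ?row and S = ?rest])
    show "measure_pmf.prob ?A {f. ?row f} \<le> return_prob p (map v (x # xs))"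
      by (rule row_prob_le[OF assms(1) Cons.prems])
    show "measure_pmf.prob ?B {g. ?rest f g} \<le> (\<Prod>k<length xs. return_prob p (drop k (map v xs)))" for f
      by (rule Cons.IH[OF d])
    show "0 \<le> (\<Prod>k<length xs. return_prob p (drop k (map v xs)))"
      by (intro prod_nonneg ballI less_imp_le return_prob_pos p)
  qed
  also have "\<dots> = (\<Prod>k<length (x # xs). return_prob p (drop k (map v (x # xs))))"
    unfolding length_Cons prod.lessThan_Suc_shift by simp
  finally show ?case unfolding split measure_map_pmf .
qed simp

lemma pmf_of_sym_sign_mats:
  "pmf_of_set (sym_sign_mats n) =
    map_pmf (\<lambda>\<epsilon>. mat n n (\<lambda>(i, j). \<epsilon> {i, j})) (Pi_pmf (edges {..<n}) 0 (\<lambda>_. sign_pmf))"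
proof -
  let ?E = "PiE_dflt (edges {..<n}) 0 (\<lambda>_. {-1, 1::int})"
  let ?f = "\<lambda>\<epsilon>. mat n n (\<lambda>(i, j). \<epsilon> {i, j}) :: int mat"
  have "bij_betw ?f ?E (sym_sign_mats n)"
    unfolding bij_betw_def
  proof
    show "inj_on ?f ?E"
    proof (rule inj_onI, rule ext)
      fix f g e assume f: "f \<in> ?E" and g: "g \<in> ?E" and eq: "?f f = ?f g"
      show "f e = g e"
      proof (cases "e \<in> edges {..<n}")
        case True
        then obtain i j where ij: "e = {i, j}" "i < n" "j < n" by (auto simp: edges_def)
        then show ?thesis using arg_cong[OF eq, of "\<lambda>M. M $$ (i, j)"] by simp
      next
        case False
        then show ?thesis using f g by (simp add: PiE_dflt_def)
      qed
    qed
    show "?f ` ?E = sym_sign_mats n"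
    proof
      show "?f ` ?E \<subseteq> sym_sign_mats n"
      proof clarify
        fix f assume "f \<in> ?E"
        then have "f {i, j} \<in> {-1, 1}" if "i < n" "j < n" for i j
          using in_edges[of i "{..<n}" j] that by (simp add: PiE_dflt_def)
        then show "?f f \<in> sym_sign_mats n"
          by (auto simp: sym_sign_mats_def insert_commute intro!: eq_matI)
      qed
      show "sym_sign_mats n \<subseteq> ?f ` ?E"
      proof
        fix M assume M: "M \<in> sym_sign_mats n"
        define f where "f e = (if e \<in> edges {..<n} then M $$ (Min e, Max e) else 0)" for e
        have sym: "M $$ (i, j) = M $$ (j, i)" if "i < n" "j < n" for i j
        proof -
          have "M $$ (i, j) = transpose_mat M $$ (i, j)"
            using M by (simp add: sym_sign_mats_def)
          also have "\<dots> = M $$ (j, i)"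
            by (rule index_transpose_mat(1)) (use M that in \<open>auto simp: sym_sign_mats_def\<close>)
          finally show ?thesis .
        qed
        have f: "f {i, j} = M $$ (i, j)" if "i < n" "j < n" for i j
          using that sym[of i j] by (auto simp: f_def in_edges min_def max_def)
        have "f \<in> ?E"
        proof -
          have "f e \<in> {-1, 1}" if e: "e \<in> edges {..<n}" for e
          proof -
            obtain i j where "e = {i, j}" "i < n" "j < n" using e by (auto simp: edges_def)
            then show ?thesis using f M by (simp add: sym_sign_mats_def)
          qed
          then show ?thesis by (auto simp: PiE_dflt_def f_def)
        qed
        moreover have "?f f = M"
          using M f by (intro eq_matI) (auto simp: sym_sign_mats_def)
        ultimately show "M \<in> ?f ` ?E" by blast
      qed
    qed
  qed
  moreover have "finite ?E" "?E \<noteq> {}" 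
    by (auto simp: finite_edges PiE_dflt_empty_iff)
  ultimately have "map_pmf ?f (pmf_of_set ?E) = pmf_of_set (sym_sign_mats n)"
    by (intro map_pmf_of_set_bij_betw)
  then show ?thesis
    by (subst Pi_pmf_of_set) (auto simp: finite_edges)
qed

lemma sym_sign_mats_prob_le:
  assumes "odd p" "distinct xs" "set xs = {..<n}" "v \<in> carrier_vec n"
  shows "measure_pmf.prob (pmf_of_set (sym_sign_mats n)) {M. map_vec (\<lambda>a. a mod int p) (M *\<^sub>v v) = w}
    \<le> (\<Prod>k<n. return_prob p (drop k (map (vec_index v) xs)))"
proof -
  let ?P = "Pi_pmf (edges (set xs)) 0 (\<lambda>_. sign_pmf)"
  have len: "length xs = n" using assms(2,3) by (metis card_lessThan distinct_card)
  have "int p dvd (\<Sum>j\<in>set xs. \<epsilon> {i, j} * vec_index v j) - vec_index w i"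
    if w: "map_vec (\<lambda>a. a mod int p) (mat n n (\<lambda>(i, j). \<epsilon> {i, j}) *\<^sub>v v) = w" and i: "i < n" for \<epsilon> i
  proof -
    have "vec_index w i = (\<Sum>j\<in>set xs. \<epsilon> {i, j} * vec_index v j) mod int p"
      using i assms(3,4) by (simp flip: w add: scalar_prod_def lessThan_atLeast0)
    then show ?thesis by (simp add: dvd_minus_mod)
  qed
  then have "measure_pmf.prob ?P ((\<lambda>\<epsilon>. mat n n (\<lambda>(i, j). \<epsilon> {i, j})) -` {M. map_vec (\<lambda>a. a mod int p) (M *\<^sub>v v) = w})
      \<le> measure_pmf.prob ?P {\<epsilon>. \<forall>i\<in>set xs. int p dvd (\<Sum>j\<in>set xs. \<epsilon> {i, j} * vec_index v j) - vec_index w i}"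
    using assms(3) by (intro measure_pmf.finite_measure_mono) auto
  also have "\<dots> \<le> (\<Prod>k<n. return_prob p (drop k (map (vec_index v) xs)))"
    using symmetric_rows_prob_le[OF assms(1,2), of "vec_index v" "vec_index w"] by (simp add: len)
  finally show ?thesis
    by (simp add: pmf_of_sym_sign_mats assms(3))
qed

lemma return_prob_filter_nonzero: "return_prob p (filter (\<lambda>a. a \<noteq> 0) T) = return_prob p T"
proof -
  have "lazy_char p (filter (\<lambda>a. a \<noteq> 0) T) t = lazy_char p T t" for t
    by (induction T) auto
  then show ?thesis by (simp add: return_prob_def)
qed

lemma rho_le_return_prob:
  assumes "odd p" "v \<in> carrier_vec n"
  shows "rho p v \<le> return_prob p (filter (\<lambda>a. a \<noteq> 0) (map (vec_index v) [0..<n]))"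
proof -
  have p: "p > 0" using assms by (auto intro!: Nat.gr0I)
  have "measure_pmf.prob (sign_seq_pmf n) {\<epsilon>. (\<Sum>i<n. \<epsilon> i * vec_index v i) mod int p = x}
      \<le> return_prob p (map (vec_index v) [0..<n])" if "x \<in> {0..<int p}" for x
  proof -
    have "int p dvd (\<Sum>i\<in>set [0..<n]. \<epsilon> i * vec_index v i) - x" if "(\<Sum>i<n. \<epsilon> i * vec_index v i) mod int p = x" for \<epsilon>
      using that by (auto simp: dvd_minus_mod lessThan_atLeast0)
    then have "measure_pmf.prob (sign_seq_pmf n) {\<epsilon>. (\<Sum>i<n. \<epsilon> i * vec_index v i) mod int p = x}
       \<le> measure_pmf.prob (sign_seq_pmf n) {\<epsilon>. int p dvd (\<Sum>i\<in>set [0..<n]. \<epsilon> i * vec_index v i) - x}"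
      by (intro measure_pmf.finite_measure_mono) auto
    also have "\<dots> \<le> return_prob p (map (vec_index v) [0..<n])"
      using sign_sum_prob_le[OF assms(1), of "[0..<n]" "vec_index v" x]
      by (simp add: sign_seq_pmf_def lessThan_atLeast0)
    finally show ?thesis .
  qed
  then show ?thesis
    unfolding rho_def return_prob_filter_nonzero using p assms(2) by (subst Max_le_iff) auto
qed

section \<open>First-fit partition and its weights\<close>

text \<open>The sublists \<open>T\<^sub>0, T\<^sub>1, \<dots>\<close>, where the new head joins the first
  one of which it is not a neighbour, if there is one among the first \<open>k\<close>. Processing
  lists from the end means that the sublists of \<open>x # u\<close> depend on \<open>x\<close>
  only through where it goes.\<close>
fun first_fit :: "nat \<Rightarrow> nat \<Rightarrow> int list \<Rightarrow> nat \<Rightarrow> int list" where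
  "first_fit p k [] = (\<lambda>_. [])"
| "first_fit p k (x # u) =
    (let T = first_fit p k u; i = (LEAST j. x \<notin> neighbours p (T j))
     in if \<exists>j<k. x \<notin> neighbours p (T j) then T(i := x # T i) else T)"

declare first_fit.simps(2) [simp del]

definition common_neighbours :: "nat \<Rightarrow> nat \<Rightarrow> int list \<Rightarrow> int set" where
  "common_neighbours p k u = {x \<in> {0..<int p}. \<forall>j<k. x \<in> neighbours p (first_fit p k u j)}"

lemma finite_common_neighbours [simp]: "finite (common_neighbours p k u)"
  by (rule finite_subset[of _ "{0..<int p}"]) (auto simp: common_neighbours_def)

lemma first_fit_Cons_cases:
  obtains (exceptional) i where "i < k" "x \<notin> neighbours p (first_fit p k u i)"
      "\<And>j. j < i \<Longrightarrow> x \<in> neighbours p (first_fit p k u j)"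
      "first_fit p k (x # u) = (first_fit p k u)(i := x # first_fit p k u i)"
  | (structured) "\<And>j. j < k \<Longrightarrow> x \<in> neighbours p (first_fit p k u j)"
      "first_fit p k (x # u) = first_fit p k u"
proof (cases "\<exists>j<k. x \<notin> neighbours p (first_fit p k u j)")
  case True
  define i where "i = (LEAST j. x \<notin> neighbours p (first_fit p k u j))"
  obtain j where j: "j < k" "x \<notin> neighbours p (first_fit p k u j)" using True by blast
  have "i \<le> j" unfolding i_def using j(2) by (rule Least_le)
  moreover have "x \<notin> neighbours p (first_fit p k u i)" unfolding i_def using j(2) by (rule LeastI)
  moreover have "x \<in> neighbours p (first_fit p k u l)" if "l < i" for l
    using not_less_Least that unfolding i_def by blast
  moreover have "first_fit p k (x # u) = (first_fit p k u)(i := x # first_fit p k u i)"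
    using True by (simp only: first_fit.simps(2) Let_def if_True flip: i_def)
  ultimately show ?thesis using j(1) by (intro exceptional) simp_all
next
  case False
  then have "first_fit p k (x # u) = first_fit p k u" by (simp only: first_fit.simps(2) Let_def if_False)
  then show ?thesis using False by (intro structured) blast+
qed

lemma set_first_fit: "set (first_fit p k u j) \<subseteq> set u"
proof (induction u arbitrary: j)
  case (Cons x u)
  show ?case
  proof (cases rule: first_fit_Cons_cases[of k x p u])
    case (exceptional i)
    then show ?thesis using Cons[of j] by auto
  next
    case structured
    then show ?thesis using Cons[of j] by auto
  qed
qed simp

text \<open>An entry either joins one sublist, and the same factor appears on both sides, or it is missing
  on the right-hand side, while the left-hand side gains a factor at most 1.\<close>
lemma lazy_char_le_prod_first_fit: "lazy_char p u t \<le> (\<Prod>j<k. lazy_char p (first_fit p k u j) t)"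
proof (induction u)
  case (Cons x u)
  show ?case
  proof (cases rule: first_fit_Cons_cases[of k x p u])
    case (exceptional i)
    have "lazy_char p (x # u) t = (3 / 4 + phase p x t / 4) * lazy_char p u t" by simp
    also have "\<dots> \<le> (3 / 4 + phase p x t / 4) * (\<Prod>j<k. lazy_char p (first_fit p k u j) t)"
      using Cons lazy_factor_bounds(1)[of p x t] by (intro mult_left_mono) auto
    also have "\<dots> = (\<Prod>j<k. lazy_char p (first_fit p k (x # u) j) t)"
    proof -
      have i: "i \<in> {..<k}" using exceptional(1) by simp
      have "(\<Prod>j<k. lazy_char p (first_fit p k (x # u) j) t)
          = (\<Prod>j<k. (if j = i then 3 / 4 + phase p x t / 4 else 1) * lazy_char p (first_fit p k u j) t)"
        unfolding exceptional(4) by (rule prod.cong) auto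
      then show ?thesis using i by (simp add: prod.distrib)
    qed
    finally show ?thesis .
  next
    case structured
    then show ?thesis using Cons lazy_char_Cons_le[of p x u t] by simp
  qed
qed simp

lemma return_prob_le_first_fit:
  assumes "j < k" shows "return_prob p u \<le> return_prob p (first_fit p k u j)"
proof (rule return_prob_mono)
  fix t
  have "lazy_char p u t \<le> (\<Prod>j<k. lazy_char p (first_fit p k u j) t)" by (rule lazy_char_le_prod_first_fit)
  also have "\<dots> = lazy_char p (first_fit p k u j) t * (\<Prod>j\<in>{..<k} - {j}. lazy_char p (first_fit p k u j) t)"
    by (rule prod.remove) (use assms in auto)
  also have "\<dots> \<le> lazy_char p (first_fit p k u j) t * 1"
    by (intro mult_left_mono prod_le_1) (auto simp: less_imp_le lazy_char_pos lazy_char_le_1)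
  finally show "lazy_char p u t \<le> lazy_char p (first_fit p k u j) t" by simp
qed

lemma return_prob_first_fit_le:
  assumes "p > 0" "set u \<subseteq> {0..<int p}"
  shows "return_prob p (first_fit p k u j) \<le> (7 / 8) ^ length (first_fit p k u j)"
  using assms(2)
proof (induction u arbitrary: j)
  case (Cons x u)
  have IH: "return_prob p (first_fit p k u j) \<le> (7 / 8) ^ length (first_fit p k u j)" for j
    using Cons by simp
  show ?case
  proof (cases rule: first_fit_Cons_cases[of k x p u])
    case (exceptional i)
    then show ?thesis
      using IH[of j] return_prob_Cons_not_neighbour[of x p "first_fit p k u i"] Cons.prems by auto
  next
    case structured
    then show ?thesis using IH by simp
  qed
qed (use assms(1) in \<open>simp add: return_prob_Nil\<close>)

lemma length_first_fit_le:
  assumes "p > 0" "set u \<subseteq> {0..<int p}" "j < k" "1 / real p \<le> return_prob p u"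
  shows "real (length (first_fit p k u j)) \<le> 8 * ln (real p)"
proof -
  let ?l = "length (first_fit p k u j)"
  have "1 / real p \<le> (7 / 8) ^ ?l"
    using assms(4) return_prob_le_first_fit[OF assms(3)] return_prob_first_fit_le[OF assms(1,2)] order_trans by meson
  then have "ln (1 / real p) \<le> ln ((7 / 8) ^ ?l)" using assms(1) by (subst ln_le_cancel_iff) auto
  then have "- ln (real p) \<le> real ?l * ln (7 / 8)" using assms(1) by (simp add: ln_div ln_realpow)
  moreover have "real ?l * ln (7 / 8) \<le> real ?l * (- 1 / 8)"
    using ln_le_minus_one[of "7 / 8 :: real"] by (intro mult_left_mono) auto
  ultimately show ?thesis by simp
qed

lemma sum_length_first_fit_Cons:
  assumes "i < k" "first_fit p k (x # u) = (first_fit p k u)(i := x # first_fit p k u i)"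
  shows "(\<Sum>j<k. length (first_fit p k (x # u) j)) = Suc (\<Sum>j<k. length (first_fit p k u j))"
proof -
  have "(\<Sum>j<k. length (first_fit p k (x # u) j)) = (\<Sum>j<k. (if j = i then 1 else 0) + length (first_fit p k u j))"
    unfolding assms(2) by (rule sum.cong) auto
  then show ?thesis using assms(1) by (simp add: sum.distrib)
qed

lemma sum_length_first_fit_le: "(\<Sum>j<k. length (first_fit p k u j)) \<le> length u"
proof (induction u)
  case (Cons x u)
  show ?case
  proof (cases rule: first_fit_Cons_cases[of k x p u])
    case (exceptional i)
    then show ?thesis using Cons sum_length_first_fit_Cons[OF exceptional(1,4)] by simp
  next
    case structured
    then show ?thesis using Cons by simp
  qed
qed simp

text \<open>The density of the uniform distribution on \<open>N\<close>, or \<open>0\<close> if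
  \<open>N\<close> is empty.\<close>
definition set_weight :: "int set \<Rightarrow> int \<Rightarrow> real" where
  "set_weight N x = indicator N x / real (card N)"

lemma sum_set_weight: "finite A \<Longrightarrow> (\<Sum>x\<in>A. set_weight N x) \<le> 1"
proof -
  assume A: "finite A"
  have "(\<Sum>x\<in>A. set_weight N x) = real (card (A \<inter> N)) / real (card N)"
    using A by (simp add: set_weight_def indicator_def sum.If_cases Int_def flip: sum_divide_distrib)
  also have "\<dots> \<le> 1"
  proof (cases "finite N")
    case True
    then have "card (A \<inter> N) \<le> card N" by (intro card_mono) auto
    then show ?thesis by (auto simp: divide_le_eq_1)
  qed simp
  finally show ?thesis .
qed

lemma set_weight_nonneg: "set_weight N x \<ge> 0"
  by (simp add: set_weight_def)

text \<open>A sub-probability on the next entry, given the entries so far. Its three summands cover the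
  three things that can happen to the next entry: it is arbitrary, it is a neighbour of
  \<open>T\<^sub>0\<close>, or it is a common neighbour of all sublists. Weighing lists by these
  conditional probabilities turns the bound for the sum over all lists into a bound for each list,
  without enumerating the patterns in which the cases occur.\<close>
definition weight :: "nat \<Rightarrow> nat \<Rightarrow> int list \<Rightarrow> int \<Rightarrow> real" where
  "weight p k u x = (set_weight {0..<int p} x + set_weight (neighbours p (first_fit p k u 0)) x
    + set_weight (common_neighbours p k u) x) / 3"

fun list_weight :: "nat \<Rightarrow> nat \<Rightarrow> int list \<Rightarrow> real" where
  "list_weight p k [] = 1"
| "list_weight p k (x # u) = weight p k u x * list_weight p k u"

lemma weight_nonneg: "weight p k u x \<ge> 0"
  by (simp add: weight_def set_weight_nonneg)

lemma list_weight_nonneg: "list_weight p k u \<ge> 0"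
  by (induction u) (auto simp: weight_nonneg)

lemma sum_weight:
  assumes "finite A" shows "(\<Sum>x\<in>A. weight p k u x) \<le> 1"
  using sum_set_weight[OF assms, of "{0..<int p}"]
    sum_set_weight[OF assms, of "neighbours p (first_fit p k u 0)"]
    sum_set_weight[OF assms, of "common_neighbours p k u"]
  by (simp add: weight_def sum.distrib flip: sum_divide_distrib)

lemma sum_list_weight:
  assumes "finite A" shows "(\<Sum>u | set u \<subseteq> A \<and> length u = m. list_weight p k u) \<le> 1"
proof (induction m)
  case 0
  have "{u. set u \<subseteq> A \<and> length u = 0} = {[]}" by auto
  then show ?case by simp
next
  case (Suc m)
  let ?U = "{u. set u \<subseteq> A \<and> length u = m}"
  have "(\<Sum>u | set u \<subseteq> A \<and> length u = Suc m. list_weight p k u)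
      = (\<Sum>(u, x)\<in>?U \<times> A. list_weight p k (x # u))"
    unfolding lists_length_Suc_eq by (subst sum.reindex) (auto simp: inj_on_def case_prod_unfold)
  also have "\<dots> = (\<Sum>u\<in>?U. (\<Sum>x\<in>A. weight p k u x) * list_weight p k u)"
    by (simp add: sum.cartesian_product[symmetric] sum_distrib_right)
  also have "\<dots> \<le> (\<Sum>u\<in>?U. 1 * list_weight p k u)"
    by (intro sum_mono mult_right_mono sum_weight assms list_weight_nonneg)
  finally show ?case using Suc by simp
qed

lemma le_weight_of_le_set_weight:
  assumes "finite N" "x \<in> N" "q * real (card N) \<le> 2 * K" 
  shows "q \<le> 6 * K * (set_weight N x / 3)"
proof -
  have "card N > 0" using assms by (auto simp: card_gt_0_iff)
  then show ?thesis using assms by (simp add: set_weight_def field_simps)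
qed

text \<open>Let \<open>T\<^sub>j\<close> be the sublist singled out by the inequality of Halasz type. It
  bounds \<open>return_prob p u\<close> by the gain times \<open>q(T\<^sub>j)\<close>, up to an
  additive \<open>1/p\<close>, which is at most \<open>q(T\<^sub>j)/b\<close>, while the common
  neighbours are neighbours of \<open>T\<^sub>j\<close>, hence at most
  \<open>2/q(T\<^sub>j)\<close> in number.\<close>
lemma return_prob_common_neighbours_le:
  assumes p: "prime p" and u: "set u \<subseteq> {1..<int p}" and k: "k = 16 ^ J"
    and x: "x \<in> common_neighbours p k u" "x \<noteq> 0"
    and b: "0 < b" "b / real p \<le> return_prob p u"
  shows "return_prob p u * real (card (common_neighbours p k u)) \<le> 2 * (1 / b + 34 * (2 / 3) ^ J)"
proof -
  have p0: "p > 0" using p by (simp add: prime_gt_0_nat)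
  let ?T = "first_fit p k u" and ?C = "common_neighbours p k u"
  have ne: "?T j \<noteq> []" if "j < k" for j
  proof
    assume "?T j = []"
    moreover have "x \<in> neighbours p (?T j)" using x(1) that by (simp add: common_neighbours_def)
    ultimately show False using neighbours_Nil[of p] x(2) by auto
  qed
  have ndvd: "\<not> int p dvd a" if "a \<in> set (?T j)" for a j
  proof -
    have "a \<in> {1..<int p}" using set_first_fit[of p k u j] u that by blast
    then show ?thesis by (intro zdvd_not_zless) auto
  qed
  obtain j where j: "j < k" "(\<Sum>t\<in>{0..<int p}. \<Prod>j<k. lazy_char p (?T j) t) / real p
      \<le> 1 / real p + 34 * (2 / 3) ^ J * return_prob p (?T j)"
    using exists_return_prob_of_product_le[OF p, of J ?T] ne ndvd unfolding k by blast
  define q where "q = return_prob p (?T j)"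
  have q: "q > 0" using p0 by (simp add: q_def return_prob_pos)
  have "return_prob p u \<le> 1 / real p + 34 * (2 / 3) ^ J * q"
    unfolding q_def using j(2)
    by (rule order_trans[rotated])
      (auto simp: return_prob_def intro!: divide_right_mono sum_mono lazy_char_le_prod_first_fit)
  moreover have "real (card ?C) \<le> 2 / q"
  proof -
    have "card ?C \<le> card (neighbours p (?T j))"
      using j(1) by (intro card_mono) (auto simp: common_neighbours_def)
    then have "real (card ?C) * q \<le> real (card (neighbours p (?T j))) * q"
      using q by (intro mult_right_mono) auto
    also have "\<dots> \<le> 2" unfolding q_def by (rule card_neighbours_le[OF p0])
    finally show ?thesis using q by (simp add: pos_le_divide_eq)
  qed
  ultimately have "return_prob p u * real (card ?C) \<le> (1 / real p + 34 * (2 / 3) ^ J * q) * (2 / q)"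
    using q by (intro mult_mono) auto
  also have "\<dots> = 2 * (1 / (real p * q) + 34 * (2 / 3) ^ J)"
    using q by (simp add: add_divide_distrib)
  also have "\<dots> \<le> 2 * (1 / b + 34 * (2 / 3) ^ J)"
  proof -
    have "b / real p \<le> q" using b(2) return_prob_le_first_fit[OF j(1), of p u] by (simp add: q_def)
    then have "b \<le> real p * q" using p0 by (simp add: field_simps)
    then show ?thesis using b(1) by (simp add: frac_le)
  qed
  finally show ?thesis .
qed

lemma return_prob_Cons_le: "return_prob p (x # u) \<le> return_prob p u"
  by (intro return_prob_mono lazy_char_Cons_le)

text \<open>Each entry contributes its return probability, which is at most its weight times
  \<open>6p\<close> if it joins \<open>T\<^sub>0\<close>, times 6 if it joins a later sublist, and
  times \<open>6K\<close> otherwise.\<close>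
lemma prod_return_prob_le_list_weight:
  assumes p: "prime p" and u: "set u \<subseteq> {1..<int p}" and k: "k = 16 ^ J"
    and b: "0 < b" "b / real p \<le> return_prob p u"
  defines "K \<equiv> 1 / b + 34 * (2 / 3) ^ J"
  shows "(\<Prod>i<length u. return_prob p (drop i u))
    \<le> list_weight p k u * 6 ^ length u * real p ^ length (first_fit p k u 0)
        * K ^ (length u - (\<Sum>j<k. length (first_fit p k u j)))"
  using u b(2)
proof (induction u)
  case (Cons x u)
  have p0: "p > 0" using p by (simp add: prime_gt_0_nat)
  have K: "K > 0" using b(1) by (simp add: K_def add_pos_pos)
  let ?T = "first_fit p k"
  let ?l = "length (?T u 0)" and ?e = "length u - (\<Sum>j<k. length (?T u j))"
  let ?w = "weight p k u x" and ?W = "list_weight p k u"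
  have ux: "x \<in> {1..<int p}" "set u \<subseteq> {1..<int p}" using Cons.prems by auto
  have bu: "b / real p \<le> return_prob p u"
    using Cons.prems(2) return_prob_Cons_le[of p x u] by linarith
  have IH: "(\<Prod>i<length u. return_prob p (drop i u)) \<le> ?W * 6 ^ length u * real p ^ ?l * K ^ ?e"
    by (rule Cons.IH[OF ux(2) bu])
  have step: ?case if "return_prob p (x # u) \<le> ?w * 6 * r"
    and eq: "real p ^ length (?T (x # u) 0) * K ^ (length (x # u) - (\<Sum>j<k. length (?T (x # u) j)))
      = r * (real p ^ ?l * K ^ ?e)" for r
  proof -
    have nonneg: "0 \<le> ?w * 6 * r"
      using that(1) return_prob_pos[OF p0, of "x # u"] by linarith
    have "(\<Prod>i<length (x # u). return_prob p (drop i (x # u)))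
        = return_prob p (x # u) * (\<Prod>i<length u. return_prob p (drop i u))"
      unfolding length_Cons prod.lessThan_Suc_shift by simp
    also have "\<dots> \<le> (?w * 6 * r) * (?W * 6 ^ length u * real p ^ ?l * K ^ ?e)"
      by (intro mult_mono that(1) IH prod_nonneg nonneg) (simp add: less_imp_le return_prob_pos p0)
    also have "\<dots> = list_weight p k (x # u) * 6 ^ length (x # u) * (r * (real p ^ ?l * K ^ ?e))"
      by simp
    finally show ?thesis unfolding eq[symmetric] by (simp only: mult.assoc)
  qed
  have w: "set_weight {0..<int p} x / 3 \<le> ?w" "set_weight (neighbours p (?T u 0)) x / 3 \<le> ?w"
    "set_weight (common_neighbours p k u) x / 3 \<le> ?w"
    using set_weight_nonneg by (simp_all add: weight_def)
  show ?case
  proof (cases rule: first_fit_Cons_cases[of k x p u])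
    case (exceptional i)
    have exp_eq: "length (x # u) - (\<Sum>j<k. length (?T (x # u) j)) = ?e"
      using sum_length_first_fit_Cons[OF exceptional(1,4)] by simp
    show ?thesis
    proof (cases "i = 0")
      case True
      have "return_prob p (x # u) \<le> 6 * real p * (set_weight {0..<int p} x / 3)"
        using ux(1) p0 return_prob_le_1[of p "x # u"] by (simp add: set_weight_def)
      also have "\<dots> \<le> 6 * real p * ?w" using w(1) by (intro mult_left_mono) auto
      finally show ?thesis
        using exp_eq by (intro step[of "real p"]) (simp_all add: exceptional(4) True mult.commute mult.left_commute)
    next
      case False
      have x0: "x \<in> neighbours p (?T u 0)" using False exceptional(3) by simp
      have "0 < k" using exceptional(1) by simp
      then have "return_prob p (x # u) \<le> return_prob p (?T u 0)"
        using return_prob_Cons_le[of p x u] return_prob_le_first_fit[of 0 k p u] by linarith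
      then have "return_prob p (x # u) * real (card (neighbours p (?T u 0)))
          \<le> return_prob p (?T u 0) * real (card (neighbours p (?T u 0)))"
        by (rule mult_right_mono) simp
      also have "\<dots> \<le> 2 * 1"
        using card_neighbours_le[OF p0, of "?T u 0"] by (simp add: mult.commute)
      finally have "return_prob p (x # u) \<le> 6 * 1 * (set_weight (neighbours p (?T u 0)) x / 3)"
        by (intro le_weight_of_le_set_weight x0) auto
      also have "\<dots> \<le> ?w * 6 * 1" using w(2) by simp
      finally show ?thesis
        using False exp_eq by (intro step[of 1]) (simp_all add: exceptional(4))
    qed
  next
    case structured
    have xC: "x \<in> common_neighbours p k u"
      using structured(1) ux(1) by (auto simp: common_neighbours_def)
    have "return_prob p (x # u) * real (card (common_neighbours p k u))
        \<le> return_prob p u * real (card (common_neighbours p k u))"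
      by (intro mult_right_mono return_prob_Cons_le) simp
    also have "\<dots> \<le> 2 * K"
      unfolding K_def using xC ux by (intro return_prob_common_neighbours_le[OF p _ k _ _ b(1) bu]) auto
    finally have "return_prob p (x # u) \<le> 6 * K * (set_weight (common_neighbours p k u) x / 3)"
      by (intro le_weight_of_le_set_weight xC) simp_all
    also have "\<dots> \<le> 6 * K * ?w" using w(3) K by (intro mult_left_mono) auto
    also have "\<dots> = ?w * 6 * K" by simp
    finally show ?thesis
      using sum_length_first_fit_le[where k = k and p = p and u = u] by (intro step[of K]) (simp_all add: structured(2) Suc_diff_le)
  qed
qed simp

section \<open>Summing over all vectors\<close>

definition support :: "int vec \<Rightarrow> nat list" where
  "support v = filter (\<lambda>i. vec_index v i \<noteq> 0) [0..<dim_vec v]"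

definition entries :: "int vec \<Rightarrow> int list" where
  "entries v = map (vec_index v) (support v)"

abbreviation image_prob :: "nat \<Rightarrow> nat \<Rightarrow> int vec \<Rightarrow> real" where
  "image_prob p n v \<equiv> Max ((\<lambda>w. measure_pmf.prob (pmf_of_set (sym_sign_mats n))
      {M. map_vec (\<lambda>a. a mod int p) (M *\<^sub>v v) = w}) ` Zp_vec p n)"

lemma dim_Zp_vec: "v \<in> Zp_vec p n \<Longrightarrow> dim_vec v = n"
  by (auto simp: Zp_vec_def)

lemma length_entries [simp]: "length (entries v) = length (support v)"
  by (simp add: entries_def)

lemma length_support_le: "v \<in> Zp_vec p n \<Longrightarrow> length (support v) \<le> n"
  using length_filter_le[of "\<lambda>i. vec_index v i \<noteq> 0" "[0..<n]"] by (simp add: support_def dim_Zp_vec)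

lemma set_entries: "v \<in> Zp_vec p n \<Longrightarrow> set (entries v) \<subseteq> {1..<int p}"
  by (force simp: entries_def support_def Zp_vec_def)

text \<open>The return probability ignores zeros. So listing the zero entries of a vector first makes each
  of them contribute the return probability of the whole vector.\<close>
lemma prod_return_prob_replicate:
  "(\<Prod>i<r + length u. return_prob p (drop i (replicate r 0 @ u)))
    = return_prob p u ^ r * (\<Prod>i<length u. return_prob p (drop i u))"
proof (induction r)
  case (Suc r)
  have "return_prob p (replicate l 0 @ u) = return_prob p u" for l
    using return_prob_filter_nonzero[of p "replicate l 0 @ u"] return_prob_filter_nonzero[of p u]
    by simp
  from this[of "Suc r"] show ?case
    using Suc unfolding add_Suc prod.lessThan_Suc_shift by simp
qed simp

lemma image_prob_le:
  assumes "odd p" "v \<in> Zp_vec p n"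
  shows "image_prob p n v \<le> return_prob p (entries v) ^ (n - length (support v)) *
    (\<Prod>i<length (support v). return_prob p (drop i (entries v)))"
proof -
  have p: "p > 0" using assms by (auto intro!: Nat.gr0I)
  have v: "v \<in> carrier_vec n" "dim_vec v = n" using assms(2) by (auto simp: Zp_vec_def)
  define zeros where "zeros = filter (\<lambda>i. vec_index v i = 0) [0..<n]"
  define xs where "xs = zeros @ support v"
  have "distinct xs" "set xs = {..<n}" by (auto simp: xs_def zeros_def support_def v(2))
  moreover have len: "length zeros + length (support v) = n"
    using sum_length_filter_compl[of "\<lambda>i. vec_index v i = 0" "[0..<n]"]
    by (simp add: zeros_def support_def v(2))
  moreover have "map (vec_index v) zeros = replicate (length zeros) 0"
    by (intro replicate_eqI) (auto simp: zeros_def)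
  then have "map (vec_index v) xs = replicate (length zeros) 0 @ entries v"
    by (simp add: xs_def entries_def)
  ultimately have "measure_pmf.prob (pmf_of_set (sym_sign_mats n)) {M. map_vec (\<lambda>a. a mod int p) (M *\<^sub>v v) = w}
      \<le> return_prob p (entries v) ^ length zeros * (\<Prod>i<length (support v). return_prob p (drop i (entries v)))" for w
    using sym_sign_mats_prob_le[OF assms(1), of xs n v w] v
      prod_return_prob_replicate[where r = "length zeros" and u = "entries v" and p = p] by simp
  moreover have "Zp_vec p n \<noteq> {}" using assms(2) by blast
  moreover have "n - length (support v) = length zeros" using len by simp
  ultimately show ?thesis by (subst Max_le_iff) (auto simp: finite_Zp_vec)
qed

lemma rho_le_entries: "odd p \<Longrightarrow> v \<in> Zp_vec p n \<Longrightarrow> rho p v \<le> return_prob p (entries v)"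
  using rho_le_return_prob[of p v n] by (simp add: entries_def support_def dim_Zp_vec filter_map comp_def) (simp add: Zp_vec_def)

lemma return_prob_le_three_quarters:
  assumes "p > 0" "T \<noteq> []" "set T \<subseteq> {1..<int p}"
  shows "return_prob p T \<le> 3 / 4"
proof -
  obtain a T' where T: "T = a # T'" using assms(2) by (cases T) auto
  have "lazy_char p T t \<le> lazy_char p [a] t" for t
    using lazy_factor_bounds(1)[of p a t] lazy_char_le_1[of p T' t]
    by (simp add: T mult_left_le)
  then have "return_prob p T \<le> return_prob p [a]" by (rule return_prob_mono)
  also have "\<not> int p dvd a" using assms(3) by (intro zdvd_not_zless) (auto simp: T)
  then have "return_prob p [a] = 3 / 4" by (rule return_prob_single[OF assms(1)])
  finally show ?thesis .
qed

lemma support_eq_Nil: "v \<in> Zp_vec p n \<Longrightarrow> support v = [] \<Longrightarrow> v = 0\<^sub>v n"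
  by (intro eq_vecI) (auto simp: Zp_vec_def support_def filter_empty_conv)

lemma image_prob_le_exp_dim:
  assumes "odd p" "v \<in> Zp_vec p n" "v \<noteq> 0\<^sub>v n"
  shows "image_prob p n v \<le> (3 / 4) ^ n"
proof -
  have p: "p > 0" using assms by (auto intro!: Nat.gr0I)
  let ?u = "entries v" and ?m = "length (support v)"
  have m: "?m \<le> n" by (rule length_support_le[OF assms(2)])
  have u: "set ?u \<subseteq> {1..<int p}" by (rule set_entries[OF assms(2)])
  have drop: "return_prob p (drop i ?u) \<le> 3 / 4" if "i < ?m" for i
    using that set_drop_subset[of i ?u] u by (intro return_prob_le_three_quarters p) auto
  have nn: "0 \<le> return_prob p T" for T using return_prob_pos[OF p] by (rule less_imp_le)
  have "0 < ?m" using support_eq_Nil[OF assms(2)] assms(3) by auto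
  then have "return_prob p ?u \<le> 3 / 4" using drop[of 0] by simp
  then have "return_prob p ?u ^ (n - ?m) * (\<Prod>i<?m. return_prob p (drop i ?u))
      \<le> (3 / 4) ^ (n - ?m) * (\<Prod>i<?m. 3 / 4)"
    by (intro mult_mono power_mono prod_mono prod_nonneg) (use drop nn in auto)
  also have "\<dots> = (3 / 4) ^ n" using m by (simp flip: power_add)
  finally show ?thesis using image_prob_le[OF assms(1,2)] by linarith
qed

text \<open>The inequality of Halasz type for singleton lists.\<close>
lemma return_prob_long_le:
  assumes p: "prime p" and u: "set u \<subseteq> {1..<int p}" and long: "16 ^ J \<le> length u"
  shows "return_prob p u \<le> 1 / real p + 34 * (2 / 3) ^ J"
proof -
  let ?T = "\<lambda>j. [u ! j]"
  have "\<not> int p dvd u ! j" if "j < 16 ^ J" for j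
  proof -
    have "u ! j \<in> set u" using that long by (intro nth_mem) linarith
    then have "u ! j \<in> {1..<int p}" using u by blast
    then show ?thesis by (intro zdvd_not_zless) auto
  qed
  then obtain j where j: "(\<Sum>t\<in>{0..<int p}. \<Prod>j<16 ^ J. lazy_char p (?T j) t) / real p
      \<le> 1 / real p + 34 * (2 / 3) ^ J * return_prob p (?T j)"
    using exists_return_prob_of_product_le[OF p, of J ?T] by auto
  have "lazy_char p u t \<le> (\<Prod>j<16 ^ J. lazy_char p (?T j) t)" for t
  proof -
    have "lazy_char p u t = (\<Prod>j<length u. lazy_char p (?T j) t)"
      by (simp add: lazy_char_def prod.list_conv_set_nth lessThan_atLeast0)
    also have "\<dots> = (\<Prod>j\<in>{..<length u} - {..<16 ^ J}. lazy_char p (?T j) t) * (\<Prod>j<16 ^ J. lazy_char p (?T j) t)"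
      using long by (intro prod.subset_diff) auto
    also have "\<dots> \<le> (\<Prod>j<16 ^ J. lazy_char p (?T j) t)"
      by (intro mult_left_le_one_le prod_le_1 prod_nonneg conjI ballI)
        (rule less_imp_le[OF lazy_char_pos] lazy_char_le_1)+
    finally show ?thesis .
  qed
  then have "return_prob p u \<le> (\<Sum>t\<in>{0..<int p}. \<Prod>j<16 ^ J. lazy_char p (?T j) t) / real p"
    by (auto simp: return_prob_def intro!: divide_right_mono sum_mono)
  also note j
  also have "1 / real p + 34 * (2 / 3) ^ J * return_prob p (?T j) \<le> 1 / real p + 34 * (2 / 3) ^ J * 1"
    by (intro add_left_mono mult_left_mono return_prob_le_1) auto
  finally show ?thesis by simp
qed

text \<open>Zero entries gain a factor \<open>K\<close> as well: the vector has at least \<open>k\<close>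
  nonzero entries, so its return probability is at most \<open>K\<close> by
  \<open>return_prob_long_le\<close>. So all \<open>n\<close> entries gain \<open>K\<close>,
  except for the at most \<open>k * d\<close> that join one of the sublists.\<close>
lemma image_prob_le_list_weight:
  assumes p: "prime p" "odd p" and v: "v \<in> Zp_vec p n" and k: "k = 16 ^ J" "k \<le> length (support v)"
    and b: "1 \<le> b" "b / real p \<le> return_prob p (entries v)"
    and K: "K = 1 / b + 34 * (2 / 3) ^ J" "K \<le> 1" and d: "8 * ln (real p) \<le> real d"
  shows "image_prob p n v \<le> list_weight p k (entries v) * (6 ^ n * real p ^ d * K ^ (n - k * d))"
proof -
  let ?u = "entries v" and ?m = "length (support v)"
  let ?e = "\<Sum>j<k. length (first_fit p k ?u j)"
  have p0: "p > 0" "real p \<ge> 1" using p(1) prime_gt_0_nat[of p] by auto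
  have K0: "K \<ge> 0" using b(1) by (simp add: K(1))
  have m: "?m \<le> n" by (rule length_support_le[OF v])
  have u: "set ?u \<subseteq> {1..<int p}" by (rule set_entries[OF v])
  have nn: "0 \<le> return_prob p T" for T using return_prob_pos[OF p0(1)] by (rule less_imp_le)
  have "b / real p \<le> 1" using b(2) return_prob_le_1[of p ?u] by linarith
  then have "1 / real p \<le> 1 / b" using b(1) p0 by (simp add: frac_le)
  moreover have "return_prob p ?u \<le> 1 / real p + 34 * (2 / 3) ^ J"
    using k by (intro return_prob_long_le p u) simp
  ultimately have uK: "return_prob p ?u \<le> K" by (simp add: K(1))
  have len: "length (first_fit p k ?u j) \<le> d" if "j < k" for j
  proof -
    have "1 / real p \<le> b / real p" using b(1) by (intro divide_right_mono) auto
    then have "real (length (first_fit p k ?u j)) \<le> 8 * ln (real p)"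
      using u b(2) by (intro length_first_fit_le p0 that) (auto simp: subset_iff)
    then show ?thesis using d by linarith
  qed
  then have e: "?e \<le> k * d" using sum_bounded_above[of "{..<k}" "\<lambda>j. length (first_fit p k ?u j)" d] by simp
  have em: "?e \<le> ?m" using sum_length_first_fit_le[where k = k and p = p and u = ?u] by simp
  have main: "(\<Prod>i<?m. return_prob p (drop i ?u))
      \<le> list_weight p k ?u * 6 ^ ?m * real p ^ length (first_fit p k ?u 0) * K ^ (?m - ?e)"
    using prod_return_prob_le_list_weight[OF p(1) u k(1) _ b(2)] b(1) by (simp add: K(1))
  have "image_prob p n v \<le> return_prob p ?u ^ (n - ?m) * (\<Prod>i<?m. return_prob p (drop i ?u))"
    by (rule image_prob_le[OF p(2) v])
  also have "\<dots> \<le> K ^ (n - ?m) *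
      (list_weight p k ?u * 6 ^ ?m * real p ^ length (first_fit p k ?u 0) * K ^ (?m - ?e))"
    by (intro mult_mono power_mono uK main prod_nonneg) (auto simp: nn K0)
  also have "\<dots> = list_weight p k ?u * (6 ^ ?m * real p ^ length (first_fit p k ?u 0) * K ^ (n - ?e))"
  proof -
    have "n - ?e = (n - ?m) + (?m - ?e)" using m em by simp
    then show ?thesis by (simp add: power_add)
  qed
  also have "\<dots> \<le> list_weight p k ?u * (6 ^ n * real p ^ d * K ^ (n - k * d))"
    using len[of 0] k m e K K0 p0
    by (intro mult_left_mono mult_mono power_increasing power_decreasing list_weight_nonneg) auto
  finally show ?thesis .
qed

lemma Zp_vec_eqI_support:
  assumes "v \<in> Zp_vec p n" "w \<in> Zp_vec p n" "support v = support w" "entries v = entries w"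
  shows "v = w"
proof (rule eq_vecI)
  show "dim_vec v = dim_vec w" using assms(1,2) by (auto simp: Zp_vec_def)
  fix i assume i: "i < dim_vec w"
  show "vec_index v i = vec_index w i"
  proof (cases "i \<in> set (support v)")
    case True
    then show ?thesis using assms(3,4) by (auto simp: entries_def)
  next
    case False
    then have "i \<notin> set (support w)" using assms(3) by simp
    with False have "vec_index v i = 0" "vec_index w i = 0"
      using i assms(1,2) by (simp_all add: support_def dim_Zp_vec)
    then show ?thesis by simp
  qed
qed

text \<open>A vector is determined by its support, for which there are \<open>2 ^ n\<close> choices, and by
  its list of nonzero entries.\<close>
lemma sum_list_weight_entries:
  assumes "V \<subseteq> Zp_vec p n"
  shows "(\<Sum>v\<in>V. list_weight p k (entries v)) \<le> 2 ^ n"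
proof -
  let ?A = "{0..<int p}"
  let ?U = "\<lambda>m. {u. set u \<subseteq> ?A \<and> length u = m}"
  let ?\<phi> = "\<lambda>v. (set (support v), entries v)"
  have inj: "inj_on ?\<phi> V"
  proof (rule inj_onI)
    fix v w assume vw: "v \<in> V" "w \<in> V" "?\<phi> v = ?\<phi> w"
    have "support v = sorted_list_of_set (set (support v))" for v
      unfolding support_def
      by (rule sorted_list_of_set.idem_if_sorted_distinct[symmetric]) (simp_all add: sorted_wrt_filter)
    then have "support v = support w" using vw(3) by (metis fst_conv)
    then show "v = w" using vw assms by (intro Zp_vec_eqI_support[of v p n w]) auto
  qed
  have "(\<Sum>v\<in>V. list_weight p k (entries v)) = (\<Sum>(S, u)\<in>?\<phi> ` V. list_weight p k u)"
    by (simp add: sum.reindex[OF inj])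
  also have "\<dots> \<le> (\<Sum>(S, u)\<in>Sigma (Pow {..<n}) (\<lambda>S. ?U (card S)). list_weight p k u)"
  proof (rule sum_mono2)
    show "finite (Sigma (Pow {..<n}) (\<lambda>S. ?U (card S)))"
      by (intro finite_SigmaI finite_lists_length_eq) auto
    show "?\<phi> ` V \<subseteq> Sigma (Pow {..<n}) (\<lambda>S. ?U (card S))"
    proof
      fix y assume "y \<in> ?\<phi> ` V"
      then obtain v where v: "v \<in> Zp_vec p n" "y = ?\<phi> v" using assms by auto
      have "distinct (support v)" by (simp add: support_def)
      then have "card (set (support v)) = length (entries v)" by (simp only: distinct_card length_entries)
      then show "y \<in> Sigma (Pow {..<n}) (\<lambda>S. ?U (card S))"
        using v set_entries[OF v(1)] by (auto simp: support_def Zp_vec_def)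
    qed
  qed (auto simp: list_weight_nonneg)
  also have "\<dots> = (\<Sum>S\<in>Pow {..<n}. \<Sum>u\<in>?U (card S). list_weight p k u)"
    by (subst sum.Sigma) (auto intro: finite_lists_length_eq)
  also have "\<dots> \<le> (\<Sum>S\<in>Pow {..<n}. 1)"
    by (intro sum_mono sum_list_weight) simp
  also have "\<dots> = 2 ^ n" by (simp add: card_Pow)
  finally show ?thesis .
qed

text \<open>A vector with fewer than \<open>k\<close> nonzero entries is determined by the list of their
  positions and values.\<close>
lemma card_sparse_le:
  assumes "1 \<le> n" "1 \<le> p"
  shows "real (card {v \<in> Zp_vec p n. length (support v) < k}) \<le> (real k + 1) * (real n * real p) ^ k"
proof -
  let ?V = "{v \<in> Zp_vec p n. length (support v) < k}"
  let ?A = "{..<n} \<times> {0..<int p}"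
  let ?\<phi> = "\<lambda>v. zip (support v) (entries v)"
  have inj: "inj_on ?\<phi> ?V"
  proof (rule inj_onI)
    fix v w assume vw: "v \<in> ?V" "w \<in> ?V" "?\<phi> v = ?\<phi> w"
    have "support v = support w" "entries v = entries w"
      using arg_cong[OF vw(3), of "map fst"] arg_cong[OF vw(3), of "map snd"] by simp_all
    then show "v = w" using vw by (intro Zp_vec_eqI_support[of v p n w]) auto
  qed
  have "?\<phi> ` ?V \<subseteq> {xs. set xs \<subseteq> ?A \<and> length xs \<le> k}"
  proof
    fix y assume "y \<in> ?\<phi> ` ?V"
    then obtain v where v: "v \<in> Zp_vec p n" "length (support v) < k" "y = ?\<phi> v" by auto
    have "i < n \<and> a \<in> {0..<int p}" if "(i, a) \<in> set y" for i a
    proof -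
      have "i \<in> set (support v)" "a \<in> set (entries v)"
        using that unfolding v(3) by (auto dest: set_zip_leftD set_zip_rightD)
      then show ?thesis using set_entries[OF v(1)] v(1) by (auto simp: support_def Zp_vec_def)
    qed
    then show "y \<in> {xs. set xs \<subseteq> ?A \<and> length xs \<le> k}" using v by auto
  qed
  then have "card (?\<phi> ` ?V) \<le> card {xs. set xs \<subseteq> ?A \<and> length xs \<le> k}"
    by (intro card_mono finite_lists_length_le) auto
  also have "\<dots> = (\<Sum>i\<le>k. (n * p) ^ i)"
    by (subst card_lists_length_le) auto
  also have "\<dots> \<le> (\<Sum>i\<le>k. (n * p) ^ k)"
    using assms by (intro sum_mono power_increasing) auto
  also have "\<dots> = (k + 1) * (n * p) ^ k" by simp
  finally have "card ?V \<le> (k + 1) * (n * p) ^ k" by (simp add: card_image[OF inj])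
  then have "real (card ?V) \<le> real ((k + 1) * (n * p) ^ k)" by (simp only: of_nat_le_iff)
  then show ?thesis by (simp add: algebra_simps)
qed

lemma sum_image_prob_le:
  assumes p: "prime p" "odd p" and n: "1 \<le> n" and k: "k = 16 ^ J"
    and b: "1 \<le> b" "b / real p \<le> \<beta>"
    and K: "K = 1 / b + 34 * (2 / 3) ^ J" "K \<le> 1" and d: "8 * ln (real p) \<le> real d"
  shows "(\<Sum>v \<in> {v \<in> Zp_vec p n - {0\<^sub>v n}. rho p v \<ge> \<beta>}. image_prob p n v)
    \<le> (real k + 1) * (real n * real p) ^ k * (3 / 4) ^ n + 12 ^ n * real p ^ d * K ^ (n - k * d)"
proof -
  let ?V = "{v \<in> Zp_vec p n - {0\<^sub>v n}. rho p v \<ge> \<beta>}"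
  define S where "S = {v \<in> ?V. length (support v) < k}"
  define D where "D = {v \<in> ?V. k \<le> length (support v)}"
  define B where "B = 6 ^ n * real p ^ d * K ^ (n - k * d)"
  have p1: "1 \<le> p" using p using prime_gt_0_nat[of p] by simp
  have K0: "K \<ge> 0" using b(1) by (simp add: K(1))
  have B0: "B \<ge> 0" by (simp add: B_def K0)
  have fin: "finite ?V" by (rule finite_subset[OF _ finite_Zp_vec[of p n]]) auto
  have SD: "?V = S \<union> D" "S \<inter> D = {}" "finite S" "finite D" 
    by (auto simp: S_def D_def intro: finite_subset[OF _ fin])
  have "(\<Sum>v\<in>S. image_prob p n v) \<le> (\<Sum>v\<in>S. (3 / 4) ^ n)"
    using p by (intro sum_mono image_prob_le_exp_dim) (auto simp: S_def)
  also have "\<dots> = real (card S) * (3 / 4) ^ n" by simp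
  also have "\<dots> \<le> ((real k + 1) * (real n * real p) ^ k) * (3 / 4) ^ n"
  proof (rule mult_right_mono)
    have "card S \<le> card {v \<in> Zp_vec p n. length (support v) < k}"
      by (rule card_mono) (auto simp: S_def intro: finite_subset[OF _ finite_Zp_vec[of p n]])
    then show "real (card S) \<le> (real k + 1) * (real n * real p) ^ k"
      using card_sparse_le[OF n p1, of k] by linarith
  qed simp
  finally have S: "(\<Sum>v\<in>S. image_prob p n v) \<le> (real k + 1) * (real n * real p) ^ k * (3 / 4) ^ n" .
  have "(\<Sum>v\<in>D. image_prob p n v) \<le> (\<Sum>v\<in>D. list_weight p k (entries v) * B)"
    unfolding B_def
  proof (rule sum_mono)
    fix v assume "v \<in> D"
    then have v: "v \<in> Zp_vec p n" "\<beta> \<le> rho p v" "k \<le> length (support v)" by (auto simp: D_def)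
    have "b / real p \<le> return_prob p (entries v)"
      using b(2) v(2) rho_le_entries[OF p(2) v(1)] by linarith
    then show "image_prob p n v \<le> list_weight p k (entries v) * (6 ^ n * real p ^ d * K ^ (n - k * d))"
      using p v k b K d by (intro image_prob_le_list_weight)
  qed
  also have "\<dots> = (\<Sum>v\<in>D. list_weight p k (entries v)) * B" by (simp add: sum_distrib_right)
  also have "\<dots> \<le> 2 ^ n * B"
    by (intro mult_right_mono sum_list_weight_entries[of D p n] B0) (auto simp: D_def)
  also have "\<dots> = 12 ^ n * real p ^ d * K ^ (n - k * d)"
    using power_mult_distrib[of 2 "6 :: real" n] by (simp add: B_def)
  finally show ?thesis using S SD by (simp add: sum.union_disjoint)
qed

section \<open>Choice of parameters\<close>

text \<open>The parameters are \<open>k = 16 ^ J\<close> with \<open>J \<approx> ln n / 28\<close>, so that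
  \<open>k \<le> n powr (1/10)\<close>, and \<open>d \<approx> 8 ln p \<le> sqrt (n ln n) /
  100\<close>. The first two estimates compare the logarithms of the two parts of
  \<open>sum_image_prob_le\<close> with that of half of the final bound.\<close>
lemma sparse_bound_eventually:
  "\<forall>\<^sub>F n in sequentially. ln 2 + ln (real n) / 10
      + exp (ln (real n) / 10) * (ln (real n) + sqrt (real n * ln (real n)) / 800)
      - real n / 4 \<le> - real n / 800 - ln 2"
  by real_asymp

lemma dense_bound_eventually:
  "\<forall>\<^sub>F n in sequentially. real n * ln 12 + (real n * ln (real n) / 80000 + sqrt (real n * ln (real n)) / 800)
      + real n / 2 * (ln 52 - ln (real n) / 84) \<le> - real n / 800 - ln 2"
  by real_asymp

lemma exceptions_eventually:
  "\<forall>\<^sub>F n in sequentially. exp (ln (real n) / 10) * (sqrt (real n * ln (real n)) / 100 + 1) \<le> real n / 2"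
  by real_asymp

lemma gain_eventually:
  "\<forall>\<^sub>F n in sequentially. 52 * exp (- ln (real n) / 84) \<le> 1"
  by real_asymp

lemma inverse_eventually:
  fixes C :: real
  assumes "C > 0"
  shows "\<forall>\<^sub>F n in sequentially. 1 / (C * real n) \<le> exp (- ln (real n) / 84) \<and> 3 \<le> C * real n"
proof -
  have "\<forall>\<^sub>F n in sequentially. 1 / (C * real n) \<le> exp (- ln (real n) / 84)"
    using assms by real_asymp
  moreover have "\<forall>\<^sub>F n in sequentially. 3 \<le> C * real n"
    using assms by real_asymp
  ultimately show ?thesis by (rule eventually_conj)
qed

text \<open>This uses \<open>ln 16 / 28 \<le> 1/10\<close> and \<open>ln (3/2) / 28 \<ge> 1/84\<close>. The
  factor \<open>3/2\<close> pays for rounding down.\<close>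
lemma power_scale_le:
  assumes "n \<ge> (1::nat)" "J = nat \<lfloor>ln (real n) / 28\<rfloor>"
  shows "real (16 ^ J) \<le> exp (ln (real n) / 10)" "(2 / 3 :: real) ^ J \<le> 3 / 2 * exp (- ln (real n) / 84)"
proof -
  have l: "ln (real n) \<ge> 0" using assms(1) by simp
  then have J: "real J \<le> ln (real n) / 28" "ln (real n) / 28 - 1 \<le> real J"
    unfolding assms(2) by (simp_all add: of_nat_nat) linarith+
  have "ln (16 :: real) = 4 * ln 2" using ln_realpow[of 2 4] by simp
  then have "ln (16 :: real) \<le> 28 / 10" using ln2_le_25_over_36 by simp
  then have "real J * ln 16 \<le> ln (real n) / 28 * (28 / 10)" using J l by (intro mult_mono) auto
  moreover have "real (16 ^ J) = exp (real J * ln 16)"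
    by (simp add: exp_of_nat_mult)
  ultimately show "real (16 ^ J) \<le> exp (ln (real n) / 10)" by simp
  have "ln (2 / 3 :: real) \<le> - 1 / 3" using ln_le_minus_one[of "2 / 3 :: real"] by simp
  then have a: "(real J + 1) * ln (2 / 3 :: real) \<le> (real J + 1) * (- 1 / 3)"
    by (intro mult_left_mono) auto
  have "(2 / 3 :: real) ^ J = 3 / 2 * (2 / 3) ^ Suc J" by simp
  also have "(2 / 3 :: real) ^ Suc J = exp (real (Suc J) * ln (2 / 3))"
    by (subst exp_of_nat_mult) simp
  also have "\<dots> \<le> exp (- ln (real n) / 84)"
    using order_trans[OF a, of "- ln (real n) / 84"] J(2) by (simp add: add.commute)
  finally show "(2 / 3 :: real) ^ J \<le> 3 / 2 * exp (- ln (real n) / 84)" by simp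
qed

theorem theorem4:
  fixes c C1 C2 :: real
  assumes "c = 1 / 800" and "0 < C1" and "C1 \<le> C2"
  shows "\<exists>n0::nat. \<forall>n\<ge>n0. \<forall>p::nat. \<forall>\<beta>::real.
    prime p \<longrightarrow> real p \<le> exp (c * sqrt (real n * ln (real n))) \<longrightarrow>
    C1 * real n / real p \<le> \<beta> \<longrightarrow> \<beta> \<le> C2 * real n / real p \<longrightarrow>
    (\<Sum>v \<in> {v \<in> Zp_vec p n - {0\<^sub>v n}. rho p v \<ge> \<beta>}.
       Max ((\<lambda>w. measure_pmf.prob (pmf_of_set (sym_sign_mats n))
              {M. map_vec (\<lambda>a. a mod int p) (M *\<^sub>v v) = w}) ` Zp_vec p n))
      \<le> exp (- c * real n)"
proof -
  have "\<forall>\<^sub>F n in sequentially. \<forall>p::nat. \<forall>\<beta>::real.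
    prime p \<longrightarrow> real p \<le> exp (c * sqrt (real n * ln (real n))) \<longrightarrow>
    C1 * real n / real p \<le> \<beta> \<longrightarrow> \<beta> \<le> C2 * real n / real p \<longrightarrow>
    (\<Sum>v \<in> {v \<in> Zp_vec p n - {0\<^sub>v n}. rho p v \<ge> \<beta>}. image_prob p n v) \<le> exp (- c * real n)"
    using sparse_bound_eventually dense_bound_eventually exceptions_eventually gain_eventually
      inverse_eventually[OF assms(2)] eventually_ge_at_top[of 1]
  proof (eventually_elim, intro allI impI)
    fix n p :: nat and \<beta> :: real
    assume sparse: "ln 2 + ln (real n) / 10
        + exp (ln (real n) / 10) * (ln (real n) + sqrt (real n * ln (real n)) / 800)
        - real n / 4 \<le> - real n / 800 - ln 2"
      and dense: "real n * ln 12 + (real n * ln (real n) / 80000 + sqrt (real n * ln (real n)) / 800)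
        + real n / 2 * (ln 52 - ln (real n) / 84) \<le> - real n / 800 - ln 2"
      and exceptions: "exp (ln (real n) / 10) * (sqrt (real n * ln (real n)) / 100 + 1) \<le> real n / 2"
      and gain: "52 * exp (- ln (real n) / 84) \<le> 1"
      and inv: "1 / (C1 * real n) \<le> exp (- ln (real n) / 84) \<and> 3 \<le> C1 * real n"
      and n: "1 \<le> n"
      and p: "prime p" "real p \<le> exp (c * sqrt (real n * ln (real n)))"
      and \<beta>: "C1 * real n / real p \<le> \<beta>"
    let ?V = "{v \<in> Zp_vec p n - {0\<^sub>v n}. rho p v \<ge> \<beta>}"
    define s where "s = sqrt (real n * ln (real n))"
    define b where "b = C1 * real n"
    define J where "J = nat \<lfloor>ln (real n) / 28\<rfloor>"
    define k :: nat where "k = 16 ^ J"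
    define d where "d = nat \<lceil>8 * ln (real p)\<rceil>"
    define K where "K = 1 / b + 34 * (2 / 3) ^ J"
    define G where "G = 52 * exp (- ln (real n) / 84)"
    show "(\<Sum>v\<in>?V. image_prob p n v) \<le> exp (- c * real n)"
    \<comment> \<open>If \<open>b > p\<close>, then \<open>\<beta>\<close> exceeds 1 and the sum is empty; otherwise \<open>p\<close> is large, in particular odd.\<close>
    proof (cases "b \<le> real p")
      case False
      have "rho p v < \<beta>" if "v \<in> Zp_vec p n" for v
      proof -
        have "rho p v \<le> 1"
          unfolding rho_def using p(1) prime_gt_0_nat[of p] by (subst Max_le_iff) auto
        also have "1 < b / real p" using False p(1) prime_gt_0_nat[of p] by simp
        finally show ?thesis using \<beta> by (simp add: b_def)
      qed
      then have "?V = {}" by force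
      then show ?thesis by (simp only: sum.empty) simp
    next
      case True
      have p3: "p \<ge> 3" using True inv by (simp add: b_def)
      then have "odd p" using p(1) prime_odd_nat[of p] by simp
      have ln_n: "0 \<le> ln (real n)" using n by simp
      have ln_p: "0 \<le> ln (real p)" "ln (real p) \<le> s / 800"
      proof -
        have "ln (real p) \<le> ln (exp (c * s))"
          using p3 p(2) by (subst ln_le_cancel_iff) (auto simp: s_def)
        then show "ln (real p) \<le> s / 800" by (simp add: assms(1))
      qed (use p3 in simp)
      have s2: "s * s = real n * ln (real n)" using ln_n by (simp add: s_def)
      have s0: "s \<ge> 0" using ln_n by (simp add: s_def)
      have k: "real k \<le> exp (ln (real n) / 10)" unfolding k_def by (rule power_scale_le[OF n J_def])
      have KG: "K \<le> G"
        using power_scale_le(2)[OF n J_def] inv by (simp add: K_def G_def b_def)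
      have b3: "3 \<le> b" using inv by (simp add: b_def)
      have K0: "0 \<le> K" using b3 by (simp add: K_def)
      have d: "8 * ln (real p) \<le> real d" "real d \<le> s / 100 + 1"
        using ln_p unfolding d_def by linarith+
      have "real (k * d) \<le> exp (ln (real n) / 10) * (s / 100 + 1)"
        unfolding of_nat_mult using k d by (intro mult_mono) auto
      then have kd: "real (k * d) \<le> real n / 2" using exceptions by (simp add: s_def)
      have "(\<Sum>v\<in>?V. image_prob p n v) \<le> (real k + 1) * (real n * real p) ^ k * (3 / 4) ^ n
          + 12 ^ n * real p ^ d * K ^ (n - k * d)"
        using \<beta> b3 KG gain d(1) 
        by (intro sum_image_prob_le[where J = J and b = b] p(1) \<open>odd p\<close> n k_def K_def) (auto simp: b_def G_def)
      also have "(real k + 1) * (real n * real p) ^ k * (3 / 4) ^ n \<le> exp (- real n / 800 - ln 2)"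
      proof -
        have "real k + 1 \<le> exp (ln 2 + ln (real n) / 10)"
        proof -
          have "1 \<le> exp (ln (real n) / 10)" using ln_n by simp
          then have "real k + 1 \<le> 2 * exp (ln (real n) / 10)" using k by linarith
          then show ?thesis by (simp add: exp_add)
        qed
        moreover have "(real n * real p) ^ k \<le> exp (exp (ln (real n) / 10) * (ln (real n) + s / 800))"
        proof -
          have "(real n * real p) ^ k = exp (real k * (ln (real n) + ln (real p)))"
            using n p3 by (simp add: exp_of_nat_mult exp_add)
          also have "\<dots> \<le> exp (exp (ln (real n) / 10) * (ln (real n) + s / 800))"
            using k ln_n ln_p by (simp add: mult_mono)
          finally show ?thesis .
        qed
        moreover have "(3 / 4 :: real) ^ n \<le> exp (- real n / 4)"
        proof -
          have "(3 / 4 :: real) ^ n \<le> exp (- 1 / 4) ^ n"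
            using exp_ge_add_one_self[of "- 1 / 4"] by (intro power_mono) auto
          then show ?thesis by (simp flip: exp_of_nat_mult)
        qed
        ultimately have "(real k + 1) * (real n * real p) ^ k * (3 / 4) ^ n
            \<le> exp (ln 2 + ln (real n) / 10) * exp (exp (ln (real n) / 10) * (ln (real n) + s / 800)) * exp (- real n / 4)"
          by (intro mult_mono) auto
        also have "\<dots> \<le> exp (- real n / 800 - ln 2)"
          unfolding exp_add[symmetric] using sparse by (simp add: s_def)
        finally show ?thesis .
      qed
      also have "12 ^ n * real p ^ d * K ^ (n - k * d) \<le> exp (- real n / 800 - ln 2)"
      proof -
        have G: "G > 0" "ln G = ln 52 - ln (real n) / 84" by (simp_all add: G_def ln_mult)
        have "(12 :: real) ^ n = exp (real n * ln 12)" by (simp add: exp_of_nat_mult)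
        moreover have "real p ^ d \<le> exp (real n * ln (real n) / 80000 + s / 800)"
        proof -
          have "real p ^ d = exp (real d * ln (real p))" using p3 by (simp add: exp_of_nat_mult)
          also have "real d * ln (real p) \<le> (s / 100 + 1) * (s / 800)"
            using d ln_p s0 by (intro mult_mono) auto
          also have "\<dots> = real n * ln (real n) / 80000 + s / 800"
            using s2 by (simp add: distrib_right)
          finally show ?thesis by simp
        qed
        moreover have "K ^ (n - k * d) \<le> exp (real n / 2 * ln G)"
        proof -
          have "K ^ (n - k * d) \<le> G ^ (n - k * d)" by (rule power_mono[OF KG K0])
          also have "\<dots> = exp (real (n - k * d) * ln G)" using G(1) by (simp add: exp_of_nat_mult)
          also have "\<dots> \<le> exp (real n / 2 * ln G)"
          proof -
            have "ln G \<le> 0" using G(1) gain by (simp add: G_def)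
            moreover have "real n / 2 \<le> real (n - k * d)" using kd by linarith
            ultimately have "real (n - k * d) * ln G \<le> real n / 2 * ln G"
              by (intro mult_right_mono_neg)
            then show ?thesis by (simp only: exp_le_cancel_iff)
          qed
          finally show ?thesis .
        qed
        ultimately have "12 ^ n * real p ^ d * K ^ (n - k * d)
            \<le> exp (real n * ln 12) * exp (real n * ln (real n) / 80000 + s / 800) * exp (real n / 2 * ln G)"
          using K0 by (intro mult_mono) auto
        also have "\<dots> \<le> exp (- real n / 800 - ln 2)"
          unfolding exp_add[symmetric] G(2) using dense by (simp add: s_def)
        finally show ?thesis .
      qed
      also have "exp (- real n / 800 - ln 2) + exp (- real n / 800 - ln 2) = exp (- c * real n)"
        by (simp add: exp_diff assms(1))
      finally show ?thesis by simp
    qed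
  qed
  then show ?thesis unfolding eventually_sequentially .
qed

end
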